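(* Let $\mathbb{F}=\mathbb{R},\mathbb{C}$, or $\mathbb{H}$, let $n\geq 1$, and let $G$ be a nontrivial finite subgroup of the unit sphere $S(\mathbb{F})=\{u\in\mathbb{F} : |u|=1\}$ (a group under multiplication). Given any $n$ $\mathbb{F}$-valued mass distributions $\mu_1,\ldots,\mu_n$ on $\mathbb{F}^n$ and any $n$ automorphisms $\varphi_1,\ldots,\varphi_n\in \mathrm{Aut}(G)$, there exists a $G$-Voronoi partition $\{\mathcal{R}_g\}_{g\in G}=\{\mathcal{R}_g(\mathbf{a},b)\}_{g\in G}$ of $\mathbb{F}^n$ (for some $(\mathbf{a},b)\in S(\mathbb{F}^n)\times\mathbb{F}$) such that $$\sum_{g\in G}\varphi_i(g)^{-1}\mu_i(\mathcal{R}_g)=0\in\mathbb{F}$$ for each $1\leq i\leq n$.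
   Context: $\mathbb{H}$ denotes the quaternions, $d=\dim_{\mathbb{R}}\mathbb{F}\in\{1,2,4\}$, and $\mathbb{F}^n$ is identified with $\mathbb{R}^{dn}$; $S(\mathbb{F}^n)$ is the unit sphere of $\mathbb{F}^n$ for the Euclidean norm. Scalars act on $\mathbb{F}^n$ by left multiplication, and $\langle\mathbf{u},\mathbf{v}\rangle_{\mathbb{F}}=\sum_i u_i\bar v_i$. An $\mathbb{F}$-valued mass distribution on $\mathbb{F}^n$ is a function $\mu$ from the Borel sets of $\mathbb{F}^n$ to $\mathbb{F}$ such that (i) $\mu(\emptyset)=0$; (ii) $\mu(\bigcup_{i=1}^\infty E_i)=\sum_{i=1}^\infty\mu(E_i)$ for every countable collection of disjoint Borel sets, the sum converging absolutely in the Euclidean norm on $\mathbb{F}$; (iii) for each real (affine) hyperplane $H\subseteq\mathbb{R}^{dn}=\mathbb{F}^n$, $\mu(E)=0$ for every Borel set $E\subseteq H$; (iv) $\mu(\mathbb{F}^n)\neq0$. For $(\mathbf{a},b)\in S(\mathbb{F}^n)\times\mathbb{F}$, the associated $G$-Voronoi partition of $\mathbb{F}^n$ is the collection $\{\mathcal{R}_g(\mathbf{a},b)\}_{g\in G}$ of the Voronoi regions of the $|G|$ points $\bar b\mathbf{a}+g\mathbf{a}$, $g\in G$: $$\mathcal{R}_g(\mathbf{a},b)=\{\mathbf{u}\in\mathbb{F}^n : \|\mathbf{u}-\bar b\mathbf{a}-g\mathbf{a}\|\leq\|\mathbf{u}-\bar b\mathbf{a}-g'\mathbf{a}\|\ \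 \forall g'\in G\}.$$ Equivalently, $\mathcal{R}_g(\mathbf{a},b)=\{\mathbf{u} : \langle\mathbf{u},\mathbf{a}\rangle_{\mathbb{F}}=\bar b+v \text{ for some } v\in R_g\}$, where $R_g=\{v\in\mathbb{F}: |v-g|\leq|v-g'|\ \forall g'\in G\}$. The word "partition" allows overlaps along boundaries. *)

theory Defs
  imports "HOL-Analysis.Analysis" "HOL-Algebra.Group"
begin

section \<open>The quaternions\<close>

datatype quat = Quat (q_re: real) (q_i: real) (q_j: real) (q_k: real)

lemma quat_eq_iff:
  "x = y \<longleftrightarrow> q_re x = q_re y \<and> q_i x = q_i y \<and> q_j x = q_j y \<and> q_k x = q_k y"
  by (cases x; cases y) auto

instantiation quat :: ab_group_add
begin

definition "0 = Quat 0 0 0 0"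
definition "x + y = Quat (q_re x + q_re y) (q_i x + q_i y) (q_j x + q_j y) (q_k x + q_k y)"
definition "- x = Quat (- q_re x) (- q_i x) (- q_j x) (- q_k x)"
definition "x - y = Quat (q_re x - q_re y) (q_i x - q_i y) (q_j x - q_j y) (q_k x - q_k y)"

instance
  by standard
    (simp_all add: zero_quat_def plus_quat_def uminus_quat_def minus_quat_def quat_eq_iff)

end

lemma quat_group_sel [simp]:
  "q_re 0 = 0" "q_i 0 = 0" "q_j 0 = 0" "q_k 0 = 0"
  "q_re (x + y) = q_re x + q_re y" "q_i (x + y) = q_i x + q_i y"
  "q_j (x + y) = q_j x + q_j y" "q_k (x + y) = q_k x + q_k y"
  "q_re (- x) = - q_re x" "q_i (- x) = - q_i x" "q_j (- x) = - q_j x" "q_k (- x) = - q_k x"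
  "q_re (x - y) = q_re x - q_re y" "q_i (x - y) = q_i x - q_i y"
  "q_j (x - y) = q_j x - q_j y" "q_k (x - y) = q_k x - q_k y"
  by (simp_all add: zero_quat_def plus_quat_def uminus_quat_def minus_quat_def)

instantiation quat :: ring_1
begin

definition "1 = Quat 1 0 0 0"

definition "x * y = Quat
  (q_re x * q_re y - q_i x * q_i y - q_j x * q_j y - q_k x * q_k y)
  (q_re x * q_i y + q_i x * q_re y + q_j x * q_k y - q_k x * q_j y)
  (q_re x * q_j y - q_i x * q_k y + q_j x * q_re y + q_k x * q_i y)
  (q_re x * q_k y + q_i x * q_j y - q_j x * q_i y + q_k x * q_re y)"

instance
proof
  fix a b c :: quat
  show "a * b * c = a * (b * c)"
    by (simp add: times_quat_def quat_eq_iff algebra_simps)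
  show "(a + b) * c = a * c + b * c" "a * (b + c) = a * b + a * c"
    by (simp_all add: times_quat_def quat_eq_iff algebra_simps)
  show "1 * a = a" "a * 1 = a" "(0::quat) \<noteq> 1"
    by (simp_all add: times_quat_def one_quat_def quat_eq_iff)
qed

end

lemma quat_one_sel [simp]: "q_re 1 = 1" "q_i 1 = 0" "q_j 1 = 0" "q_k 1 = 0"
  by (simp_all add: one_quat_def)

lemma quat_times_sel [simp]:
  "q_re (x * y) = q_re x * q_re y - q_i x * q_i y - q_j x * q_j y - q_k x * q_k y"
  "q_i (x * y) = q_re x * q_i y + q_i x * q_re y + q_j x * q_k y - q_k x * q_j y"
  "q_j (x * y) = q_re x * q_j y - q_i x * q_k y + q_j x * q_re y + q_k x * q_i y"
  "q_k (x * y) = q_re x * q_k y + q_i x * q_j y - q_j x * q_i y + q_k x * q_re y"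
  by (simp_all add: times_quat_def)

instantiation quat :: real_algebra_1
begin

definition "scaleR r x = Quat (r * q_re x) (r * q_i x) (r * q_j x) (r * q_k x)"

instance
  by standard (simp_all add: scaleR_quat_def quat_eq_iff distrib_left distrib_right
      right_diff_distrib mult.assoc mult.left_commute)

end

lemma quat_scaleR_sel [simp]:
  "q_re (r *\<^sub>R x) = r * q_re x" "q_i (r *\<^sub>R x) = r * q_i x"
  "q_j (r *\<^sub>R x) = r * q_j x" "q_k (r *\<^sub>R x) = r * q_k x"
  by (simp_all add: scaleR_quat_def)

instantiation quat :: real_inner
begin

definition "inner x y = q_re x * q_re y + q_i x * q_i y + q_j x * q_j y + q_k x * q_k y"
definition "norm (x::quat) = sqrt (inner x x)"
definition "dist (x::quat) y = norm (x - y)"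
definition "sgn (x::quat) = x /\<^sub>R norm x"
definition
  "(uniformity :: (quat \<times> quat) filter) = (INF e\<in>{0 <..}. principal {(x, y). dist x y < e})"
definition
  "open (U :: quat set) \<longleftrightarrow> (\<forall>x\<in>U. eventually (\<lambda>(x', y). x' = x \<longrightarrow> y \<in> U) uniformity)"

instance
proof
  fix x y z :: quat and r :: real and U :: "quat set"
  show "dist x y = norm (x - y)" by (rule dist_quat_def)
  show "sgn x = x /\<^sub>R norm x" by (rule sgn_quat_def)
  show "(uniformity :: (quat \<times> quat) filter) = (INF e\<in>{0 <..}. principal {(x, y). dist x y < e})"
    by (rule uniformity_quat_def)
  show "open U \<longleftrightarrow> (\<forall>x\<in>U. \<forall>\<^sub>F (x', y) in uniformity. x' = x \<longrightarrow> y \<in> U)"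
    by (rule open_quat_def)
  show "inner x y = inner y x"
    by (simp add: inner_quat_def mult.commute)
  show "inner (x + y) z = inner x z + inner y z"
    by (simp add: inner_quat_def distrib_right)
  show "inner (r *\<^sub>R x) y = r * inner x y"
    by (simp add: inner_quat_def distrib_left mult.assoc)
  show "0 \<le> inner x x"
    by (simp add: inner_quat_def)
  show "inner x x = 0 \<longleftrightarrow> x = 0"
    by (simp add: inner_quat_def quat_eq_iff add_nonneg_eq_0_iff)
  show "norm x = sqrt (inner x x)" by (rule norm_quat_def)
qed

end

lemma norm_quat_sq: "(norm (x::quat))\<^sup>2 = (q_re x)\<^sup>2 + (q_i x)\<^sup>2 + (q_j x)\<^sup>2 + (q_k x)\<^sup>2"
  by (simp add: norm_quat_def inner_quat_def power2_eq_square)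

instantiation quat :: real_normed_div_algebra
begin

definition "inverse x =
  Quat (q_re x) (- q_i x) (- q_j x) (- q_k x) /\<^sub>R (norm x)\<^sup>2"
definition "x div y = x * inverse (y::quat)"

instance
proof
  fix x y :: quat
  have conj_norm: "Quat (q_re x) (- q_i x) (- q_j x) (- q_k x) * x = (norm x)\<^sup>2 *\<^sub>R 1"
    "x * Quat (q_re x) (- q_i x) (- q_j x) (- q_k x) = (norm x)\<^sup>2 *\<^sub>R 1"
    by (simp_all add: quat_eq_iff norm_quat_sq [unfolded power2_eq_square] power2_eq_square)
  show "x \<noteq> 0 \<Longrightarrow> inverse x * x = 1"
    by (simp add: inverse_quat_def conj_norm)
  show "x \<noteq> 0 \<Longrightarrow> x * inverse x = 1"
    by (simp add: inverse_quat_def conj_norm)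
  show "x div y = x * inverse y"
    by (simp add: divide_quat_def)
  show "inverse (0::quat) = 0"
    by (simp add: inverse_quat_def quat_eq_iff)
  have "(norm (x * y))\<^sup>2 = (norm x * norm y)\<^sup>2"
    unfolding power_mult_distrib norm_quat_sq by (simp add: power2_eq_square algebra_simps)
  then show "norm (x * y) = norm x * norm y"
    by (simp add: power2_eq_iff_nonneg)
qed

end

instantiation quat :: euclidean_space
begin

definition "Basis = {Quat 1 0 0 0, Quat 0 1 0 0, Quat 0 0 1 0, Quat 0 0 0 1}"

instance
proof
  fix x u v :: quat
  show "(Basis :: quat set) \<noteq> {}" "finite (Basis :: quat set)"
    by (simp_all add: Basis_quat_def)
  show "u \<in> Basis \<Longrightarrow> v \<in> Basis \<Longrightarrow> inner u v = (if u = v then 1 else 0)"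
    unfolding Basis_quat_def by (elim insertE emptyE) (simp_all add: inner_quat_def)
  show "(\<forall>u\<in>Basis. inner x u = 0) \<longleftrightarrow> x = 0"
    by (simp add: Basis_quat_def inner_quat_def quat_eq_iff [of x 0])
qed

end

section \<open>A common interface for the reals, the complex numbers and the quaternions\<close>

class conj_div_algebra = real_normed_div_algebra + euclidean_space +
  fixes scalar_cnj :: "'a \<Rightarrow> 'a"
  assumes scalar_cnj_add: "scalar_cnj (x + y) = scalar_cnj x + scalar_cnj y"
    and scalar_cnj_scaleR: "scalar_cnj (r *\<^sub>R x) = r *\<^sub>R scalar_cnj x"
    and scalar_cnj_mult: "scalar_cnj (x * y) = scalar_cnj y * scalar_cnj x"
    and mult_scalar_cnj: "x * scalar_cnj x = (norm x)\<^sup>2 *\<^sub>R 1"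

instantiation real :: conj_div_algebra
begin

definition "scalar_cnj (x::real) = x"

instance
  by standard (simp_all add: scalar_cnj_real_def power2_eq_square)

end

instantiation complex :: conj_div_algebra
begin

definition "scalar_cnj = cnj"

instance
proof
  fix x :: complex
  show "x * scalar_cnj x = (norm x)\<^sup>2 *\<^sub>R 1"
    by (simp add: scalar_cnj_complex_def complex_mult_cnj cmod_power2 scaleR_conv_of_real)
qed (simp_all add: scalar_cnj_complex_def)

end

instantiation quat :: conj_div_algebra
begin

definition "scalar_cnj x = Quat (q_re x) (- q_i x) (- q_j x) (- q_k x)"

instance
proof
  fix x y :: quat and r :: real
  show "scalar_cnj (x + y) = scalar_cnj x + scalar_cnj y"
    by (simp add: scalar_cnj_quat_def quat_eq_iff)
  show "scalar_cnj (r *\<^sub>R x) = r *\<^sub>R scalar_cnj x"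
    by (simp add: scalar_cnj_quat_def quat_eq_iff)
  show "scalar_cnj (x * y) = scalar_cnj y * scalar_cnj x"
    by (simp add: scalar_cnj_quat_def quat_eq_iff)
  show "x * scalar_cnj x = (norm x)\<^sup>2 *\<^sub>R 1"
    by (simp add: scalar_cnj_quat_def quat_eq_iff norm_quat_sq) (simp add: power2_eq_square)
qed

end

section \<open>Mass distributions and Voronoi regions\<close>

text \<open>The values of \<open>\<mu>\<close> on sets that are not Borel are unconstrained. The inner product
  is the real one on the underlying Euclidean space, so the sets \<open>{x. w \<bullet> x = c}\<close> with
  \<open>w \<noteq> 0\<close> are the real affine hyperplanes.\<close>

definition mass_distribution :: "(('a::conj_div_algebra ^ 'n::finite) set \<Rightarrow> 'a) \<Rightarrow> bool" where
  "mass_distribution \<mu> \<longleftrightarrow>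
     \<mu> {} = 0 \<and>
     (\<forall>E :: nat \<Rightarrow> ('a ^ 'n) set. range E \<subseteq> sets borel \<longrightarrow> disjoint_family E \<longrightarrow>
        summable (\<lambda>i. norm (\<mu> (E i))) \<and> (\<lambda>i. \<mu> (E i)) sums \<mu> (\<Union>i. E i)) \<and>
     (\<forall>w c. w \<noteq> 0 \<longrightarrow> (\<forall>E \<in> sets borel. E \<subseteq> {x. w \<bullet> x = c} \<longrightarrow> \<mu> E = 0)) \<and>
     \<mu> UNIV \<noteq> 0"

definition sphere_group :: "'a::conj_div_algebra monoid" where
  "sphere_group = \<lparr>carrier = sphere 0 1, monoid.mult = (*), one = 1\<rparr>"

lemma group_sphere_group: "group sphere_group"
proof (rule groupI)
  fix x :: 'a assume "x \<in> carrier sphere_group"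
  then show "\<exists>y\<in>carrier sphere_group. y \<otimes>\<^bsub>sphere_group\<^esub> x = \<one>\<^bsub>sphere_group\<^esub>"
    by (intro bexI [of _ "inverse x"]) (auto simp: sphere_group_def norm_inverse intro: left_inverse)
qed (auto simp: sphere_group_def norm_mult mult.assoc)

text \<open>Here \<open>c *s x\<close> is componentwise multiplication by \<open>c\<close> from the left, which matters
  for the quaternions.\<close>

definition voronoi_region ::
    "'a::conj_div_algebra set \<Rightarrow> 'a ^ 'n::finite \<Rightarrow> 'a \<Rightarrow> 'a \<Rightarrow> ('a ^ 'n) set" where
  "voronoi_region G a b g =
     {u. \<forall>g'\<in>G. norm (u - scalar_cnj b *s a - g *s a) \<le> norm (u - scalar_cnj b *s a - g' *s a)}"

end

theory Submission
  imports Defs "HOL-Homology.Homology"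
begin

text \<open>
Let \<open>f\<^sub>t(a) = (\<Sum>g. \<phi>\<^sub>i(g)\<^sup>-\<^sup>1 \<mu>\<^sub>i(R\<^sub>g(a, -t)))\<^sub>i\<close> for \<open>a\<close> in the unit sphere of \<open>F\<^sup>n\<close> and real \<open>t\<close>,
and suppose that no \<open>f\<^sub>t\<close> has a zero. Since the measures vanish on hyperplanes, \<open>f\<close> is continuous.
For large \<open>t\<close> almost all the mass lies in the region of \<open>g = 1\<close>, so \<open>f\<^sub>t\<close> is uniformly close to the
nonzero constant \<open>(\<mu>\<^sub>i(F\<^sup>n))\<^sub>i\<close>; hence \<open>f\<^sub>0\<close> is nullhomotopic as a map into \<open>F\<^sup>n - {0}\<close>.
On the other hand, an element \<open>h \<noteq> 1\<close> of \<open>G\<close>, of order \<open>p\<close>, generates free actions of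
\<open>\<int>/p\<close> on both sides, by \<open>a \<mapsto> h a\<close> and by \<open>y\<^sub>i \<mapsto> \<phi>\<^sub>i(h) y\<^sub>i\<close>, for which \<open>f\<^sub>0\<close> is equivariant.

Such a map is never nullhomotopic. Put \<open>K = n d\<close>. As the sphere has no reduced homology below
degree \<open>K - 1\<close>, it carries singular chains \<open>c\<^sub>0, \<dots>, c\<^bsub>K-1\<^esub>\<close>, \<open>c\<^sub>0\<close> a point, such that \<open>\<partial>c\<^bsub>j+1\<^esub>\<close> is
\<open>c\<^sub>j - h c\<^sub>j\<close> for even \<open>j\<close> and \<open>\<Sum>\<^sub>s h\<^sup>s c\<^sub>j\<close> for odd \<open>j\<close>; a nullhomotopy continues the image of this
sequence in \<open>F\<^sup>n - {0}\<close> by one more chain, of degree \<open>K\<close>. The target is covered by \<open>K\<close>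
families of \<open>p\<close> disjoint closed sets permuted cyclically, which label its points by
\<open>{0..<K} \<times> \<int>/p\<close>. Explicit cocycles of the cyclic group on words of labels (products of the carry
cocycle) evaluate to \<open>\<plusminus>1\<close> modulo \<open>p\<close> on every chain of the sequence, but after subdivision they
vanish in degree \<open>K\<close>, because \<open>K + 1\<close> labels cannot have distinct first components.
\<close>

section \<open>Cochains on words of labels\<close>

text \<open>The simplicial coboundary on words, by recursion on the first letter;
  \<open>codiff_eq_sum\<close> recovers the alternating sum over omitted letters.\<close>

fun codiff :: "('a list \<Rightarrow> int) \<Rightarrow> 'a list \<Rightarrow> int" where
  "codiff A [] = 0"
| "codiff A (x # w) = A w - codiff (\<lambda>v. A (x # v)) w"

lemma codiff_eq_sum:
  "codiff A w = (\<Sum>k<length w. (-1) ^ k * A (take k w @ drop (Suc k) w))"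
proof (induction w arbitrary: A)
  case (Cons x w)
  show ?case
    unfolding codiff.simps Cons.IH list.size(4) add_0_right add_Suc_right
    by (subst sum.lessThan_Suc_shift) (simp add: sum_negf)
qed simp

lemma codiff_diff: "codiff (\<lambda>v. A v - B v) w = codiff A w - codiff B w"
  by (induction w arbitrary: A B) auto

lemma codiff_cmul: "codiff (\<lambda>v. c * A v) w = c * codiff A w"
  by (induction w arbitrary: A) (auto simp: algebra_simps)

text \<open>Congruence modulo \<open>p\<close> is phrased as divisibility of a difference, so that
  \<open>p = 0\<close> gives equality.\<close>

lemma codiff_dvd:
  assumes "\<And>v. length w = Suc (length v) \<Longrightarrow> set v \<subseteq> set w \<Longrightarrow> p dvd A v - B v"
  shows "p dvd codiff A w - codiff B w"
  using assms
proof (induction w arbitrary: A B)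
  case (Cons x w)
  have 1: "p dvd A w - B w"
    by (rule Cons.prems) auto
  have 2: "p dvd codiff (\<lambda>v. A (x # v)) w - codiff (\<lambda>v. B (x # v)) w"
    by (rule Cons.IH, rule Cons.prems) auto
  show ?case
    using dvd_diff [OF 1 2] by (simp add: algebra_simps)
qed simp

lemma codiff_cong:
  assumes "\<And>v. length w = Suc (length v) \<Longrightarrow> A v = B v"
  shows "codiff A w = codiff B w"
  using codiff_dvd [of w 0 A B] assms by simp

lemma codiff_codiff: "codiff (codiff A) w = 0"
proof (induction w arbitrary: A)
  case (Cons x w)
  then show ?case
    by (simp add: codiff_diff)
qed simp

lemma codiff_map: "codiff A (map f w) = codiff (\<lambda>v. A (map f v)) w"
  by (induction w arbitrary: A) auto

section \<open>Reduction to words sorted by index\<close>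

fun top_letter :: "(nat \<times> 'a) list \<Rightarrow> nat \<times> 'a" where
  "top_letter [x] = x"
| "top_letter (x # y # w) = (let m = top_letter (y # w) in if fst x < fst m then m else x)"

lemma top_letter_in: "w \<noteq> [] \<Longrightarrow> top_letter w \<in> set w"
  by (induction w rule: top_letter.induct) (auto simp: Let_def)

lemma top_letter_ge: "x \<in> set w \<Longrightarrow> fst x \<le> fst (top_letter w)"
  by (induction w rule: top_letter.induct) (auto simp: Let_def)

lemma top_letter_map:
  assumes "\<And>x. fst (f x) = fst x" "w \<noteq> []"
  shows "top_letter (map f w) = f (top_letter w)"
  using assms by (induction w rule: top_letter.induct) (auto simp: Let_def)

text \<open>This is dual to barycentric subdivision, the barycentre of a word being labelled by a letter
  of maximal index. It reduces statements about cochains to words that are sorted by index.\<close>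

primrec sort_pullback ::
    "nat \<Rightarrow> ((nat \<times> 'a) list \<Rightarrow> int) \<Rightarrow> (nat \<times> 'a) list \<Rightarrow> int" where
  "sort_pullback 0 A w = A w"
| "sort_pullback (Suc n) A w = codiff (sort_pullback n (\<lambda>v. A (top_letter w # v))) w"

lemma sort_pullback_diff:
  "sort_pullback n (\<lambda>v. A v - B v) = (\<lambda>w. sort_pullback n A w - sort_pullback n B w)"
proof (induction n arbitrary: A B)
  case (Suc n)
  show ?case
    by (rule ext) (simp only: sort_pullback.simps Suc.IH codiff_diff)
qed (simp add: fun_eq_iff)

lemma sort_pullback_cmul:
  "sort_pullback n (\<lambda>v. c * A v) = (\<lambda>w. c * sort_pullback n A w)"
proof (induction n arbitrary: A)
  case (Suc n)
  show ?case
    by (rule ext) (simp only: sort_pullback.simps Suc.IH codiff_cmul)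
qed (simp add: fun_eq_iff)

text \<open>Each step prepends a letter of maximal index in the word whose faces come next, so
  \<open>A\<close> is only evaluated on words with weakly decreasing indices.\<close>

lemma sort_pullback_dvd:
  assumes "length w = Suc n"
    and "\<And>v. length v = Suc n \<Longrightarrow> set v \<subseteq> set w \<Longrightarrow> sorted_wrt (\<lambda>x y. fst y \<le> fst x) v \<Longrightarrow>
           p dvd A v - B v"
  shows "p dvd sort_pullback n A w - sort_pullback n B w"
  using assms
proof (induction n arbitrary: A B w)
  case 0
  then obtain x where "w = [x]"
    by (auto simp: length_Suc_conv)
  then show ?case
    using 0 by simp
next
  case (Suc n)
  have "w \<noteq> []" using Suc.prems(1) by auto
  show ?case
    unfolding sort_pullback.simps
  proof (rule codiff_dvd)
    fix v assume v: "length w = Suc (length v)" "set v \<subseteq> set w"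
    show "p dvd sort_pullback n (\<lambda>v. A (top_letter w # v)) v - sort_pullback n (\<lambda>v. B (top_letter w # v)) v"
    proof (rule Suc.IH)
      show "length v = Suc n" using v Suc.prems(1) by simp
      fix u :: "(nat \<times> 'a) list"
      assume u: "length u = Suc n" "set u \<subseteq> set v" "sorted_wrt (\<lambda>x y. fst y \<le> fst x) u"
      show "p dvd A (top_letter w # u) - B (top_letter w # u)"
        by (rule Suc.prems(2))
          (use u v top_letter_in [OF \<open>w \<noteq> []\<close>] in \<open>auto intro!: top_letter_ge\<close>)
    qed
  qed
qed

lemma sort_pullback_cong:
  assumes "length w = Suc n"
    and "\<And>v. length v = Suc n \<Longrightarrow> A v = B v"
  shows "sort_pullback n A w = sort_pullback n B w"
  using sort_pullback_dvd [of w n 0 A B] assms by simp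

text \<open>For the top letter \<open>m\<close>, \<open>codiff A (m # v)\<close> is
  \<open>A v\<close> minus the coboundary of \<open>\<lambda>v. A (m # v)\<close> at
  \<open>v\<close>. By induction the second part contributes a double coboundary, which
  vanishes.\<close>

lemma sort_pullback_codiff:
  assumes "length w = Suc (Suc n)"
  shows "sort_pullback (Suc n) (codiff A) w = codiff (sort_pullback n A) w"
  using assms
proof (induction n arbitrary: A w)
  case 0
  then obtain x y where "w = [x, y]"
    by (auto simp: length_Suc_conv numeral_2_eq_2)
  then show ?case
    by simp
next
  case (Suc n)
  let ?A = "\<lambda>v. A (top_letter w # v)"
  have "sort_pullback (Suc (Suc n)) (codiff A) w
      = codiff (sort_pullback (Suc n) A) w - codiff (sort_pullback (Suc n) (codiff ?A)) w"
    unfolding sort_pullback.simps(2) [of "Suc n"] codiff.simps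
    by (simp only: sort_pullback_diff codiff_diff)
  also have "codiff (sort_pullback (Suc n) (codiff ?A)) w = codiff (codiff (sort_pullback n ?A)) w"
    by (rule codiff_cong, rule Suc.IH) (use Suc.prems in auto)
  finally show ?case
    by (simp add: codiff_codiff)
qed

lemma sort_pullback_map:
  assumes "\<And>x. fst (f x) = fst x" "length w = Suc n"
  shows "sort_pullback n A (map f w) = sort_pullback n (\<lambda>v. A (map f v)) w"
  using assms(2)
proof (induction n arbitrary: A w)
  case (Suc n)
  then have "w \<noteq> []" by auto
  then show ?case
    using Suc
    by (auto simp: codiff_map top_letter_map [of f, OF assms(1)] intro!: codiff_cong)
qed simp

section \<open>The carry cocycle and the cochains of the cyclic group\<close>

definition carry :: "int \<Rightarrow> int \<Rightarrow> int \<Rightarrow> int \<Rightarrow> int" where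
  "carry p x y z = ((z - y) mod p - (z - x) mod p + (y - x) mod p) div p"

text \<open>The linear parts of the three remainders cancel, so the coboundary of
  \<open>(y - x) mod p\<close> is a multiple of \<open>p\<close> and the \<open>div\<close> in
  \<open>carry\<close> is exact.\<close>

lemma carry_mult: "p * carry p x y z = (z - y) mod p - (z - x) mod p + (y - x) mod p"
proof -
  have "(z - y) mod p - (z - x) mod p + (y - x) mod p
      = p * ((z - x) div p - (z - y) div p - (y - x) div p)"
    unfolding minus_mult_div_eq_mod [symmetric] by (simp add: algebra_simps)
  then show ?thesis
    unfolding carry_def by simp
qed

text \<open>In even degrees these are the cup powers of the carry cocycle of \<open>\<int>/p\<close>, in odd degrees their
  products with the class of degree one. They vanish on words with two equal neighbours.\<close>

fun lens_cochain :: "int \<Rightarrow> ('b \<times> int) list \<Rightarrow> int" where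
  "lens_cochain p [] = 0"
| "lens_cochain p [x] = 1"
| "lens_cochain p [x, y] = (snd y - snd x) mod p"
| "lens_cochain p (x # y # z # w) = carry p (snd x) (snd y) (snd z) * lens_cochain p (z # w)"

text \<open>After multiplication by \<open>p\<close> this is a coboundary of a coboundary.\<close>

lemma carry_cocycle:
  assumes "p \<noteq> 0"
  shows "carry p y z u - carry p x z u + carry p x y u - carry p x y z = 0"
proof -
  have "p * (carry p y z u - carry p x z u + carry p x y u - carry p x y z) = 0"
    by (simp only: distrib_left right_diff_distrib carry_mult)
  then show ?thesis
    using assms by simp
qed

text \<open>The faces omitting \<open>x\<close>, \<open>y\<close> or \<open>z\<close> all contain
  the factor \<open>lens_cochain p (u # w)\<close>; the cocycle identity merges their coefficients
  into the carry of \<open>x\<close>, \<open>y\<close>, \<open>z\<close>, which the other faces have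
  already.\<close>

lemma codiff_lens_cochain_rec:
  assumes "p \<noteq> 0"
  shows "codiff (lens_cochain p) (x # y # z # u # w)
       = carry p (snd x) (snd y) (snd z) * codiff (lens_cochain p) (z # u # w)"
proof -
  have "carry p (snd x) (snd y) (snd u) = carry p (snd x) (snd y) (snd z)
      + carry p (snd x) (snd z) (snd u) - carry p (snd y) (snd z) (snd u)"
    using carry_cocycle [OF assms, of "snd y" "snd z" "snd u" "snd x"] by simp
  then show ?thesis
    by (simp add: codiff_cmul) (simp add: algebra_simps)
qed

text \<open>The Bockstein relation: the class of degree one has coboundary \<open>p\<close> times
  the carry, and leading carry factors pass through the coboundary. Length \<open>2 * t + 3\<close>
  means even degree.\<close>

lemma codiff_lens_cochain_odd:
  assumes "p \<noteq> 0" "length w = 2 * t + 3"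
  shows "codiff (lens_cochain p) w = p * lens_cochain p w"
  using assms(2)
proof (induction t arbitrary: w)
  case 0
  then obtain x y z where "w = [x, y, z]"
    by (auto simp: length_Suc_conv numeral_3_eq_3)
  then show ?case
    by (simp add: carry_mult)
next
  case (Suc t)
  then obtain x y z u v where w: "w = x # y # z # u # v"
    by (auto simp: length_Suc_conv numeral_3_eq_3)
  show ?case
    using Suc.IH [of "z # u # v"] Suc.prems
    unfolding w codiff_lens_cochain_rec [OF assms(1)] by simp
qed

text \<open>Used on words of odd length. Modulo \<open>p\<close> its coboundary is the lens cochain
  one degree up; it is not rotation invariant, and the defect is, up to sign, the lens cochain of
  the same degree.\<close>

definition lens_primitive :: "int \<Rightarrow> ('b \<times> int) list \<Rightarrow> int" where
  "lens_primitive p w = lens_cochain p w * snd (last w)"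

lemma codiff_lens_primitive_rec:
  assumes "p \<noteq> 0"
  shows "codiff (lens_primitive p) (x # y # z # u # w)
       = carry p (snd x) (snd y) (snd z) * codiff (lens_primitive p) (z # u # w)"
proof -
  have eq: "lens_primitive p (x' # y' # z' # v) = carry p (snd x') (snd y') (snd z') * lens_primitive p (z' # v)"
    for x' y' z' :: "'b \<times> int" and v
    by (simp add: lens_primitive_def)
  have "carry p (snd x) (snd y) (snd u) = carry p (snd x) (snd y) (snd z)
      + carry p (snd x) (snd z) (snd u) - carry p (snd y) (snd z) (snd u)"
    using carry_cocycle [OF assms, of "snd y" "snd z" "snd u" "snd x"] by simp
  then show ?thesis
    by (simp add: eq codiff_cmul) (simp add: algebra_simps)
qed

lemma codiff_lens_primitive_even:
  assumes "p \<noteq> 0" "length w = 2 * t + 2"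
  shows "p dvd lens_cochain p w - codiff (lens_primitive p) w"
  using assms(2)
proof (induction t arbitrary: w)
  case 0
  then obtain x y where "w = [x, y]"
    by (auto simp: length_Suc_conv numeral_2_eq_2)
  then show ?case
    by (simp add: lens_primitive_def mod_eq_dvd_iff [symmetric])
next
  case (Suc t)
  then obtain x y z u v where w: "w = x # y # z # u # v"
    by (auto simp: length_Suc_conv numeral_2_eq_2)
  have "p dvd lens_cochain p (z # u # v) - codiff (lens_primitive p) (z # u # v)"
    using Suc.prems by (intro Suc.IH) (simp add: w)
  then have "p dvd carry p (snd x) (snd y) (snd z) *
      (lens_cochain p (z # u # v) - codiff (lens_primitive p) (z # u # v))"
    by (rule dvd_mult)
  then show ?case
    unfolding w codiff_lens_primitive_rec [OF assms(1)] by (simp add: right_diff_distrib)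
qed

definition rotate_letter :: "int \<Rightarrow> 'b \<times> int \<Rightarrow> 'b \<times> int" where
  "rotate_letter p x = (fst x, (snd x + 1) mod p)"

lemma fst_rotate_letter [simp]: "fst (rotate_letter p x) = fst x"
  by (simp add: rotate_letter_def)

lemma lens_cochain_rotate: "lens_cochain p (map (rotate_letter p) w) = lens_cochain p w"
proof -
  have *: "((r + 1) mod p - (s + 1) mod p) mod p = (r - s) mod p" for p r s :: int
    by (simp add: mod_diff_eq)
  show ?thesis
    by (induction p w rule: lens_cochain.induct) (simp_all add: rotate_letter_def carry_def *)
qed

text \<open>Rotation fixes the factor \<open>lens_cochain\<close> and raises the last label by one
  modulo \<open>p\<close>.\<close>

lemma lens_primitive_rotate:
  assumes "w \<noteq> []"
  shows "p dvd lens_primitive p w - lens_primitive p (map (rotate_letter p) w) - (- lens_cochain p w)"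
proof -
  define r where "r = snd (last w)"
  have "p dvd (r + 1) - (r + 1) mod p"
    by (simp add: minus_mod_eq_mult_div)
  then have "p dvd lens_cochain p w * ((r + 1) - (r + 1) mod p)"
    by (rule dvd_mult)
  moreover have "snd (last (map (rotate_letter p) w)) = (r + 1) mod p"
    using assms by (simp add: last_map rotate_letter_def r_def)
  ultimately show ?thesis
    using assms
    by (simp add: lens_primitive_def lens_cochain_rotate r_def [symmetric] algebra_simps del: last_map)
qed

text \<open>Pigeonhole: among \<open>K + 1\<close> letters sorted by fewer than \<open>K + 1\<close>
  indices two neighbours share the index, hence the second component, and the cochain vanishes on
  such words.\<close>

lemma lens_cochain_eq_0:
  assumes "sorted_wrt (\<lambda>x y. fst y \<le> fst x) w" "\<And>x. x \<in> set w \<Longrightarrow> fst x < (K::nat)"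
    and "\<And>x y. x \<in> set w \<Longrightarrow> y \<in> set w \<Longrightarrow> fst x = fst y \<Longrightarrow> snd x = snd y"
    and "length w = Suc K"
  shows "lens_cochain p w = 0"
proof -
  have degenerate: "lens_cochain p w = 0" if "Suc k < length w" "snd (w ! k) = snd (w ! Suc k)" for k
    using that
  proof (induction p w arbitrary: k rule: lens_cochain.induct)
    case (4 p x y z w)
    consider "k = 0" | "k = Suc 0" | l where "k = Suc (Suc l)"
      by (metis not0_implies_Suc)
    then show ?case
    proof cases
      case 3
      then show ?thesis
        using "4.IH" [of l] "4.prems" by simp
    qed (use "4.prems" in \<open>auto simp: carry_def\<close>)
  qed auto
  have "\<exists>k. Suc k < length w \<and> fst (w ! k) = fst (w ! Suc k)"
  proof (rule ccontr)
    assume no: "\<nexists>k. Suc k < length w \<and> fst (w ! k) = fst (w ! Suc k)"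
    \<comment> \<open>Without such neighbours the index drops by at least one at each
      position.\<close>
    have "fst (w ! k) + k < K" if "k < length w" for k
      using that
    proof (induction k)
      case 0
      then show ?case using assms(2) by auto
    next
      case (Suc k)
      then have "fst (w ! Suc k) \<le> fst (w ! k)"
        using assms(1) by (simp add: sorted_wrt_iff_nth_less)
      moreover have "fst (w ! Suc k) \<noteq> fst (w ! k)"
        using no Suc.prems by force
      ultimately show ?case
        using Suc by simp
    qed
    from this [of K] show False
      using assms(4) by simp
  qed
  then obtain k where "Suc k < length w" "fst (w ! k) = fst (w ! Suc k)"
    by blast
  moreover from this have "snd (w ! k) = snd (w ! Suc k)"
    by (intro assms(3)) auto
  ultimately show ?thesis
    using degenerate by blast
qed

section \<open>Evaluating cochains on singular chains\<close>

text \<open>The linear extension of \<open>\<phi>\<close>. Since \<open>frag_extend\<close> takes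
  values in formal sums, the integers are modelled as formal sums over a single generator.\<close>

definition chain_eval :: "('b \<Rightarrow> int) \<Rightarrow> ('b \<Rightarrow>\<^sub>0 int) \<Rightarrow> int" where
  "chain_eval \<phi> c = Poly_Mapping.lookup (frag_extend (\<lambda>x. frag_cmul (\<phi> x) (frag_of ())) c) ()"

lemma chain_eval_0 [simp]: "chain_eval \<phi> 0 = 0"
  by (simp add: chain_eval_def)

lemma chain_eval_of [simp]: "chain_eval \<phi> (frag_of x) = \<phi> x"
  by (simp add: chain_eval_def)

lemma chain_eval_diff: "chain_eval \<phi> (a - b) = chain_eval \<phi> a - chain_eval \<phi> b"
  by (simp add: chain_eval_def frag_extend_diff lookup_minus)

lemma chain_eval_add: "chain_eval \<phi> (a + b) = chain_eval \<phi> a + chain_eval \<phi> b"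
  by (simp add: chain_eval_def frag_extend_add lookup_add)

lemma chain_eval_cmul: "chain_eval \<phi> (frag_cmul k a) = k * chain_eval \<phi> a"
  by (simp add: chain_eval_def frag_extend_cmul)

lemma chain_eval_sum: "chain_eval \<phi> (sum f I) = (\<Sum>i\<in>I. chain_eval \<phi> (f i))"
  by (induction I rule: infinite_finite_induct) (simp_all add: chain_eval_add)

lemma chain_eval_extend:
  "chain_eval \<phi> (frag_extend b c) = chain_eval (\<lambda>x. chain_eval \<phi> (b x)) c"
  by (rule frag_induction [of c UNIV]) (simp_all add: frag_extend_diff chain_eval_diff)

lemma chain_eval_dvd:
  assumes "\<And>x. x \<in> Poly_Mapping.keys c \<Longrightarrow> p dvd \<phi> x - \<psi> x"
  shows "p dvd chain_eval \<phi> c - chain_eval \<psi> c"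
proof -
  have "p dvd chain_eval \<phi> d - chain_eval \<psi> d" if "Poly_Mapping.keys d \<subseteq> Poly_Mapping.keys c" for d
    using that
  proof (induction d rule: frag_induction)
    case (diff a b)
    then show ?case
      using dvd_diff [of p "chain_eval \<phi> a - chain_eval \<psi> a" "chain_eval \<phi> b - chain_eval \<psi> b"]
      by (simp add: chain_eval_diff algebra_simps)
  qed (use assms in auto)
  then show ?thesis by blast
qed

lemma chain_eval_cong:
  assumes "\<And>x. x \<in> Poly_Mapping.keys c \<Longrightarrow> \<phi> x = \<psi> x"
  shows "chain_eval \<phi> c = chain_eval \<psi> c"
  using chain_eval_dvd [of c 0 \<phi> \<psi>] assms by simp

lemma chain_eval_fun_diff: "chain_eval (\<lambda>x. \<phi> x - \<psi> x) c = chain_eval \<phi> c - chain_eval \<psi> c"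
  by (rule frag_induction [of c UNIV]) (simp_all add: chain_eval_diff)

lemma chain_eval_fun_cmul: "chain_eval (\<lambda>x. k * \<phi> x) c = k * chain_eval \<phi> c"
  by (rule frag_induction [of c UNIV]) (simp_all add: chain_eval_diff right_diff_distrib)

section \<open>Cochains given by labels of vertices\<close>

definition vertices :: "nat \<Rightarrow> ((nat \<Rightarrow> real) \<Rightarrow> 'a) \<Rightarrow> 'a list" where
  "vertices n \<sigma> = map (\<lambda>k. \<sigma> (\<lambda>i. if i = k then 1 else 0)) [0..<Suc n]"

lemma length_vertices [simp]: "length (vertices n \<sigma>) = Suc n"
  by (simp add: vertices_def)

lemma nth_vertices: "k \<le> n \<Longrightarrow> vertices n \<sigma> ! k = \<sigma> (\<lambda>i. if i = k then 1 else 0)"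
  by (simp add: vertices_def del: upt_Suc)

lemma vertices_subset: "set (vertices n \<sigma>) \<subseteq> \<sigma> ` standard_simplex n"
  by (auto simp: vertices_def simp del: upt_Suc)

lemma vertices_simplex_map: "vertices n (simplex_map n f \<sigma>) = map f (vertices n \<sigma>)"
  by (auto simp: vertices_def simplex_map_def simp del: upt_Suc)

lemma vertices_singular_face:
  assumes "k \<le> Suc n"
  shows "vertices n (singular_face (Suc n) k \<sigma>)
       = take k (vertices (Suc n) \<sigma>) @ drop (Suc k) (vertices (Suc n) \<sigma>)"
proof (rule nth_equalityI)
  fix j assume "j < length (vertices n (singular_face (Suc n) k \<sigma>))"
  then have j: "j \<le> n" by simp
  have face: "simplical_face k (\<lambda>i. if i = j then 1 else 0)
      = (\<lambda>i. if i = (if j < k then j else Suc j) then 1 else (0::real))"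
    by (auto simp: simplical_face_def fun_eq_iff)
  show "vertices n (singular_face (Suc n) k \<sigma>) ! j
      = (take k (vertices (Suc n) \<sigma>) @ drop (Suc k) (vertices (Suc n) \<sigma>)) ! j"
    using j assms by (auto simp: nth_vertices nth_append singular_face_def face min_def)
qed (use assms in simp)

definition label_cochain ::
    "('a \<Rightarrow> nat \<times> int) \<Rightarrow> nat \<Rightarrow> ((nat \<times> int) list \<Rightarrow> int) \<Rightarrow> ((nat \<Rightarrow> real) \<Rightarrow> 'a) \<Rightarrow> int" where
  "label_cochain L n A \<sigma> = sort_pullback n A (map L (vertices n \<sigma>))"

text \<open>Stokes' formula: a face of a simplex omits one vertex, and \<open>sort_pullback\<close>
  commutes with the coboundary.\<close>

lemma label_cochain_boundary:
  "chain_eval (label_cochain L n A) (chain_boundary (Suc n) c)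
 = chain_eval (label_cochain L (Suc n) (codiff A)) c"
proof -
  have "chain_eval (label_cochain L n A)
          (\<Sum>k\<le>Suc n. frag_cmul ((-1) ^ k) (frag_of (singular_face (Suc n) k \<sigma>)))
      = label_cochain L (Suc n) (codiff A) \<sigma>" for \<sigma>
  proof -
    have "label_cochain L (Suc n) (codiff A) \<sigma>
        = codiff (sort_pullback n A) (map L (vertices (Suc n) \<sigma>))"
      unfolding label_cochain_def by (rule sort_pullback_codiff) simp
    also have "\<dots> = (\<Sum>k\<le>Suc n. (-1) ^ k * label_cochain L n A (singular_face (Suc n) k \<sigma>))"
      unfolding codiff_eq_sum
      by (intro sum.cong)
        (auto simp: label_cochain_def vertices_singular_face take_map drop_map lessThan_Suc_atMost)
    finally show ?thesis
      by (simp add: chain_eval_sum chain_eval_cmul del: sum.atMost_Suc)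
  qed
  then show ?thesis
    by (simp add: chain_boundary_def chain_eval_extend del: sum.atMost_Suc)
qed

lemma label_cochain_chain_map:
  assumes c: "singular_chain n Y c"
    and L: "\<And>y. y \<in> topspace Y \<Longrightarrow> L (f y) = g (L y)" and g: "\<And>x. fst (g x) = fst x"
  shows "chain_eval (label_cochain L n A) (chain_map n f c)
       = chain_eval (label_cochain L n (\<lambda>w. A (map g w))) c"
  unfolding chain_map_def chain_eval_extend
proof (rule chain_eval_cong)
  fix \<sigma> assume "\<sigma> \<in> Poly_Mapping.keys c"
  then have "singular_simplex n Y \<sigma>"
    using c by (auto simp: singular_chain_def)
  then have "set (vertices n \<sigma>) \<subseteq> topspace Y"
    using vertices_subset [of n \<sigma>] by (auto simp: singular_simplex_def continuous_map_def)
  then have "map L (map f (vertices n \<sigma>)) = map g (map L (vertices n \<sigma>))"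
    using L by auto
  then show "chain_eval (label_cochain L n A) ((frag_of \<circ> simplex_map n f) \<sigma>)
      = label_cochain L n (\<lambda>w. A (map g w)) \<sigma>"
    by (simp add: label_cochain_def vertices_simplex_map sort_pullback_map [of g, OF g] del: map_map)
qed

text \<open>The elements \<open>1 - T\<close> and \<open>1 + T + ... + T^(p-1)\<close> that
  alternate in the periodic resolution of the cyclic group of order \<open>p\<close>.\<close>

definition orbit_chain :: "nat \<Rightarrow> ('a \<Rightarrow> 'a) \<Rightarrow> nat \<Rightarrow> 'a chain \<Rightarrow> 'a chain" where
  "orbit_chain p T n c =
     (if even n then c - chain_map n T c else (\<Sum>s<p. chain_map n (T ^^ s) c))"

text \<open>On \<open>c - T c\<close> the primitive measures its own failure to be rotation
  invariant, which is \<open>- lens_cochain\<close> modulo \<open>p\<close>.\<close>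

lemma label_cochain_orbit_even:
  assumes c: "singular_chain n Y c" and "even n" and "0 < p"
    and L: "\<And>y. y \<in> topspace Y \<Longrightarrow> L (T y) = rotate_letter (int p) (L y)"
  shows "int p dvd chain_eval (label_cochain L n (lens_primitive (int p))) (orbit_chain p T n c)
           + chain_eval (label_cochain L n (lens_cochain (int p))) c"
proof -
  let ?r = "map (rotate_letter (int p)) :: (nat \<times> int) list \<Rightarrow> _"
    and ?b = "lens_primitive (int p) :: (nat \<times> int) list \<Rightarrow> int"
    and ?a = "lens_cochain (int p) :: (nat \<times> int) list \<Rightarrow> int"
  have "chain_eval (label_cochain L n ?b) (orbit_chain p T n c)
      = chain_eval (label_cochain L n ?b) c - chain_eval (label_cochain L n (\<lambda>w. ?b (?r w))) c"
    using label_cochain_chain_map [OF c, of L T "rotate_letter (int p)" ?b] L \<open>even n\<close>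
    by (simp add: orbit_chain_def chain_eval_diff)
  also have "\<dots> = chain_eval (label_cochain L n (\<lambda>w. ?b w - ?b (?r w))) c"
    unfolding label_cochain_def sort_pullback_diff chain_eval_fun_diff ..
  finally have 1: "chain_eval (label_cochain L n ?b) (orbit_chain p T n c)
      = chain_eval (label_cochain L n (\<lambda>w. ?b w - ?b (?r w))) c" .
  have "int p dvd chain_eval (label_cochain L n (\<lambda>w. ?b w - ?b (?r w))) c
      - chain_eval (label_cochain L n (\<lambda>w. (-1) * ?a w)) c"
    unfolding label_cochain_def
  proof (intro chain_eval_dvd sort_pullback_dvd)
    fix w :: "(nat \<times> int) list" assume "length w = Suc n"
    then show "int p dvd ?b w - ?b (?r w) - (-1) * ?a w"
      using lens_primitive_rotate [of w "int p"] by fastforce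
  qed simp
  then show ?thesis
    unfolding 1 label_cochain_def sort_pullback_cmul chain_eval_fun_cmul by simp
qed

text \<open>By rotation invariance the cochain has the same value on all \<open>p\<close> translates
  of \<open>c\<close>.\<close>

lemma label_cochain_orbit_odd:
  assumes c: "singular_chain n Y c" and "odd n"
    and T: "\<And>y. y \<in> topspace Y \<Longrightarrow> T y \<in> topspace Y"
    and L: "\<And>y. y \<in> topspace Y \<Longrightarrow> L (T y) = rotate_letter (int p) (L y)"
  shows "chain_eval (label_cochain L n (lens_cochain (int p))) (orbit_chain p T n c)
       = int p * chain_eval (label_cochain L n (lens_cochain (int p))) c"
proof -
  let ?r = "rotate_letter (int p) :: (nat \<times> int) \<Rightarrow> _"
    and ?a = "lens_cochain (int p) :: (nat \<times> int) list \<Rightarrow> int"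
  have Ts: "(T ^^ s) y \<in> topspace Y \<and> L ((T ^^ s) y) = (?r ^^ s) (L y)" if "y \<in> topspace Y" for s y
    using that T L by (induction s) auto
  have fst: "fst ((?r ^^ s) x) = fst x" for s x
    by (induction s) auto
  have a: "?a (map (?r ^^ s) w) = ?a w" for s w
  proof (induction s)
    case (Suc s)
    have "map (?r ^^ Suc s) w = map ?r (map (?r ^^ s) w)"
      by simp
    then show ?case
      using Suc by (simp only: lens_cochain_rotate)
  qed (simp add: id_def)
  have "chain_eval (label_cochain L n ?a) (chain_map n (T ^^ s) c) = chain_eval (label_cochain L n ?a) c" for s
    using label_cochain_chain_map [OF c, of L "T ^^ s" "?r ^^ s" ?a] Ts fst by (simp add: a)
  then show ?thesis
    using \<open>odd n\<close> by (simp add: orbit_chain_def chain_eval_sum)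
qed

text \<open>The value of the lens cochain is 1 in degree 0 and changes at most by a sign modulo
  \<open>p\<close> from each degree to the next, yet it is 0 in degree \<open>K\<close>, where
  sorted label words are degenerate.\<close>

lemma no_orbit_chain_ladder:
  fixes L :: "'a \<Rightarrow> nat \<times> int"
  assumes p: "2 \<le> p"
    and d: "\<And>j. j \<le> K \<Longrightarrow> singular_chain j Y (d j)"
    and d0: "chain_eval (\<lambda>_. 1) (d 0) = 1"
    and bd: "\<And>j. j < K \<Longrightarrow> chain_boundary (Suc j) (d (Suc j)) = orbit_chain p T j (d j)"
    and T: "\<And>y. y \<in> topspace Y \<Longrightarrow> T y \<in> topspace Y"
    and L: "\<And>y. y \<in> topspace Y \<Longrightarrow> L (T y) = rotate_letter (int p) (L y)"
    and L_less: "\<And>y. y \<in> topspace Y \<Longrightarrow> fst (L y) < K"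
    and small: "\<And>\<sigma> x y. \<lbrakk>\<sigma> \<in> Poly_Mapping.keys (d K); x \<in> \<sigma> ` standard_simplex K;
                  y \<in> \<sigma> ` standard_simplex K; fst (L x) = fst (L y)\<rbrakk> \<Longrightarrow> snd (L x) = snd (L y)"
  shows False
proof -
  let ?a = "lens_cochain (int p) :: (nat \<times> int) list \<Rightarrow> int"
    and ?b = "lens_primitive (int p) :: (nat \<times> int) list \<Rightarrow> int"
  define v where "v j = chain_eval (label_cochain L j ?a) (d j)" for j
  \<comment> \<open>Modulo \<open>p\<close> the cochain is the coboundary of \<open>?b\<close>, so
    Stokes' formula moves the evaluation to \<open>d j - T (d j)\<close>, where it gives
    \<open>- v j\<close>.\<close>
  have odd_step: "int p dvd v (Suc j) + v j" if "j < K" "even j" for j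
  proof -
    from \<open>even j\<close> obtain t where t: "j = 2 * t" by blast
    have "int p dvd v (Suc j) - chain_eval (label_cochain L (Suc j) (codiff ?b)) (d (Suc j))"
      unfolding v_def label_cochain_def
      by (intro chain_eval_dvd sort_pullback_dvd codiff_lens_primitive_even [of _ _ t])
        (use p t in auto)
    moreover have "int p dvd chain_eval (label_cochain L (Suc j) (codiff ?b)) (d (Suc j)) + v j"
      using label_cochain_orbit_even [of j Y "d j" p L T] that p d [of j] L bd [of j]
      by (simp add: v_def flip: label_cochain_boundary)
    ultimately show ?thesis
      using dvd_add by fastforce
  qed
  \<comment> \<open>Here \<open>p\<close> times the cochain is a coboundary, and the sum over the
    orbit also produces a factor \<open>p\<close>, which cancels in the integers.\<close>
  have even_step: "v (Suc j) = v j" if "j < K" "odd j" for j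
  proof -
    from \<open>odd j\<close> obtain t where t: "j = 2 * t + 1" by (blast elim: oddE)
    have "int p * v (Suc j) = chain_eval (label_cochain L (Suc j) (\<lambda>w. int p * ?a w)) (d (Suc j))"
      unfolding v_def label_cochain_def sort_pullback_cmul chain_eval_fun_cmul ..
    also have "\<dots> = chain_eval (label_cochain L (Suc j) (codiff ?a)) (d (Suc j))"
      unfolding label_cochain_def
      by (intro chain_eval_cong sort_pullback_cong codiff_lens_cochain_odd [of _ _ t, symmetric])
        (use p t in auto)
    also have "\<dots> = int p * v j"
      using label_cochain_orbit_odd [of j Y "d j" T L p] that d [of j] T L bd [of j]
      by (simp add: v_def flip: label_cochain_boundary)
    finally show ?thesis
      using p by simp
  qed
  have "int p dvd v j - 1 \<or> int p dvd v j + 1" if "j \<le> K" for j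
    using that
  proof (induction j)
    case 0
    have "label_cochain L 0 ?a = (\<lambda>_. 1)"
      by (rule ext) (simp add: label_cochain_def vertices_def)
    then show ?case
      using d0 by (simp add: v_def)
  next
    case (Suc j)
    show ?case
    proof (cases "even j")
      case True
      then have "int p dvd v (Suc j) + v j"
        using odd_step Suc by simp
      moreover have "v (Suc j) + 1 = (v (Suc j) + v j) - (v j - 1)" "v (Suc j) - 1 = (v (Suc j) + v j) - (v j + 1)"
        by simp_all
      ultimately show ?thesis
        using Suc by (metis Suc_leD dvd_diff)
    qed (use Suc even_step in auto)
  qed
  moreover have "v K = chain_eval (\<lambda>_. 0) (d K)"
    unfolding v_def
  proof (rule chain_eval_cong)
    fix \<sigma> assume \<sigma>: "\<sigma> \<in> Poly_Mapping.keys (d K)"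
    then have "singular_simplex K Y \<sigma>"
      using d by (auto simp: singular_chain_def)
    then have sub: "set (vertices K \<sigma>) \<subseteq> topspace Y"
      using vertices_subset [of K \<sigma>] by (auto simp: singular_simplex_def continuous_map_def)
    \<comment> \<open>The zero cochain is written as \<open>0 * ?a w\<close> so that linearity of
      \<open>sort_pullback\<close> evaluates it; the divisor 0 turns the congruence lemma into an
      equality.\<close>
    have "label_cochain L K ?a \<sigma> = sort_pullback K (\<lambda>w. 0 * ?a w) (map L (vertices K \<sigma>))"
    proof -
      have "0 dvd sort_pullback K ?a (map L (vertices K \<sigma>))
          - sort_pullback K (\<lambda>w. 0 * ?a w) (map L (vertices K \<sigma>))"
      proof (rule sort_pullback_dvd)
        fix w :: "(nat \<times> int) list"
        assume w: "length w = Suc K" "set w \<subseteq> set (map L (vertices K \<sigma>))"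
          "sorted_wrt (\<lambda>x y. fst y \<le> fst x) w"
        have "?a w = 0"
        proof (rule lens_cochain_eq_0 [OF w(3) _ _ w(1)])
          fix x assume "x \<in> set w"
          then show "fst x < K"
            using w(2) sub L_less by auto
        next
          fix x y assume "x \<in> set w" "y \<in> set w" "fst x = fst y"
          then obtain x' y' where "x = L x'" "y = L y'" "x' \<in> set (vertices K \<sigma>)" "y' \<in> set (vertices K \<sigma>)"
            using w(2) unfolding set_map by blast
          then show "snd x = snd y"
            using small [OF \<sigma>, of x' y'] vertices_subset [of K \<sigma>] \<open>fst x = fst y\<close>
            by (simp add: subset_iff)
        qed
        then show "0 dvd ?a w - 0 * ?a w"
          by simp
      qed simp
      then show ?thesis
        by (simp add: label_cochain_def)
    qed
    then show "label_cochain L K ?a \<sigma> = 0"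
      unfolding sort_pullback_cmul by simp
  qed
  then have "v K = 0"
    using chain_eval_fun_cmul [of 0 "\<lambda>_. 0" "d K"] by simp
  ultimately have "int p dvd 1"
    by fastforce
  then show False
    using p by simp
qed

section \<open>Equivariant maps of spheres are not nullhomotopic\<close>

lemma singular_chain_subdivision_power:
  "singular_chain j Y c \<Longrightarrow> singular_chain j Y ((singular_subdivision j ^^ m) c)"
  by (induction m) (auto simp: singular_chain_singular_subdivision)

lemma chain_boundary_subdivision_power:
  assumes "singular_chain (Suc j) Y c"
  shows "chain_boundary (Suc j) ((singular_subdivision (Suc j) ^^ m) c)
       = (singular_subdivision j ^^ m) (chain_boundary (Suc j) c)"
proof (induction m)
  case (Suc m)
  show ?case
    using chain_boundary_singular_subdivision [OF singular_chain_subdivision_power [OF assms, of m]] Suc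
    by simp
qed simp

lemma subdivision_power_chain_map:
  assumes "singular_chain j Y c"
  shows "(singular_subdivision j ^^ m) (chain_map j f c) = chain_map j f ((singular_subdivision j ^^ m) c)"
proof (induction m)
  case (Suc m)
  then show ?case
    using naturality_singular_subdivision [OF singular_chain_subdivision_power [OF assms, of m], of f] by simp
qed simp

lemma subdivision_power_sum:
  fixes g :: "'b \<Rightarrow> 'a chain"
  shows "finite I \<Longrightarrow> (singular_subdivision j ^^ m) (sum g I) = (\<Sum>i\<in>I. (singular_subdivision j ^^ m) (g i))"
proof -
  have add: "(singular_subdivision j ^^ m) (a + b) = (singular_subdivision j ^^ m) a + (singular_subdivision j ^^ m) b" for a b :: "'a chain"
    by (induction m) (auto simp: singular_subdivision_add)
  show "finite I \<Longrightarrow> ?thesis"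
    by (induction I rule: finite_induct) (simp_all add: add)
qed

lemma subdivision_power_orbit_chain:
  assumes "singular_chain j Y c"
  shows "(singular_subdivision j ^^ m) (orbit_chain p T j c)
       = orbit_chain p T j ((singular_subdivision j ^^ m) c)"
  by (simp add: orbit_chain_def singular_subdivision_power_diff subdivision_power_sum
      subdivision_power_chain_map [OF assms])

lemma subdivision_power_0: "singular_chain 0 Y c \<Longrightarrow> (singular_subdivision 0 ^^ m) c = c"
  by (induction m) (auto simp: singular_subdivision_zero)

text \<open>A point is labelled by the least row \<open>i\<close> that contains it and its position
  \<open>r\<close> in that row; \<open>T\<close> keeps the row and advances the position.
  Subdivision makes the top chain small and respects the ladder, as it commutes with boundaries and
  chain maps.\<close>

lemma no_orbit_chain_ladder_closed_cover:
  assumes p: "2 \<le> p"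
    and d: "\<And>j. j \<le> K \<Longrightarrow> singular_chain j Y (d j)"
    and d0: "chain_eval (\<lambda>_. 1) (d 0) = 1"
    and bd: "\<And>j. j < K \<Longrightarrow> chain_boundary (Suc j) (d (Suc j)) = orbit_chain p T j (d j)"
    and T: "\<And>y. y \<in> topspace Y \<Longrightarrow> T y \<in> topspace Y"
    and F: "\<And>i r. i < K \<Longrightarrow> r < p \<Longrightarrow> closedin Y (F i r)"
    and cover: "\<And>y. y \<in> topspace Y \<Longrightarrow> \<exists>i<K. \<exists>r<p. y \<in> F i r"
    and disj: "\<And>i r s. \<lbrakk>i < K; r < p; s < p; r \<noteq> s\<rbrakk> \<Longrightarrow> F i r \<inter> F i s = {}"
    and F_T: "\<And>i r y. \<lbrakk>i < K; r < p; y \<in> topspace Y\<rbrakk> \<Longrightarrow> T y \<in> F i (Suc r mod p) \<longleftrightarrow> y \<in> F i r"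
  shows False
proof -
  define idx where "idx y = (LEAST i. i < K \<and> (\<exists>r<p. y \<in> F i r))" for y
  define rot where "rot y = (THE r. r < p \<and> y \<in> F (idx y) r)" for y
  define L where "L y = (idx y, int (rot y))" for y
  have idx: "idx y < K" "\<exists>r<p. y \<in> F (idx y) r" if "y \<in> topspace Y" for y
    using LeastI_ex [of "\<lambda>i. i < K \<and> (\<exists>r<p. y \<in> F i r)"] cover [OF that]
    by (auto simp: idx_def)
  have rotI: "rot y = r" if "y \<in> topspace Y" "r < p" "y \<in> F (idx y) r" for y r
    unfolding rot_def
    by (rule the_equality) (use that disj [OF idx(1) [OF that(1)]] in blast)+
  have rot: "rot y < p" "y \<in> F (idx y) (rot y)" if "y \<in> topspace Y" for y
    using idx(2) [OF that] rotI [OF that] by auto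
  have in_T: "(\<exists>r<p. T y \<in> F i r) \<longleftrightarrow> (\<exists>r<p. y \<in> F i r)" if "i < K" "y \<in> topspace Y" for i y
  proof
    assume "\<exists>r<p. T y \<in> F i r"
    then obtain r where r: "r < p" "T y \<in> F i r" by blast
    \<comment> \<open>The predecessor of \<open>r\<close> modulo \<open>p\<close>.\<close>
    let ?s = "if r = 0 then p - 1 else r - 1"
    have "Suc ?s mod p = r" "?s < p"
      using r p by auto
    then show "\<exists>r<p. y \<in> F i r"
      using F_T [OF \<open>i < K\<close> \<open>?s < p\<close> \<open>y \<in> topspace Y\<close>] r by metis
  next
    assume "\<exists>r<p. y \<in> F i r"
    then obtain r where "r < p" "y \<in> F i r" by blast
    then show "\<exists>r<p. T y \<in> F i r"
      using F_T [OF \<open>i < K\<close> \<open>r < p\<close> \<open>y \<in> topspace Y\<close>] p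
      by (intro exI [of _ "Suc r mod p"]) auto
  qed
  have idx_T: "idx (T y) = idx y" if "y \<in> topspace Y" for y
    unfolding idx_def using in_T [OF _ that] by (intro arg_cong [where f = Least] ext) blast
  have L_T: "L (T y) = rotate_letter (int p) (L y)" if "y \<in> topspace Y" for y
  proof -
    have "rot (T y) = Suc (rot y) mod p"
      using p F_T [OF idx(1) [OF that] rot(1) [OF that] that] rot [OF that]
      by (intro rotI T that) (auto simp: idx_T that)
    then show ?thesis
      by (simp add: L_def rotate_letter_def idx_T that zmod_int add.commute)
  qed
  \<comment> \<open>Every set \<open>F i r\<close> that meets \<open>U x\<close> contains
    \<open>x\<close>. Hence two points of \<open>U x\<close> labelled by the same row have the same
    position, because \<open>x\<close> lies in at most one set of that row.\<close>
  define U where "U x = topspace Y - \<Union>((\<lambda>(i, r). F i r) ` {(i, r). i < K \<and> r < p \<and> x \<notin> F i r})" for x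
  have U_open: "openin Y (U x)" for x
    unfolding U_def
  proof (intro openin_diff openin_topspace closedin_Union)
    have "finite {(i, r). i < K \<and> r < p \<and> x \<notin> F i r}"
      by (rule finite_subset [of _ "{..<K} \<times> {..<p}"]) auto
    then show "finite ((\<lambda>(i, r). F i r) ` {(i, r). i < K \<and> r < p \<and> x \<notin> F i r})"
      by blast
  qed (use F in auto)
  have U_cover: "topspace Y \<subseteq> \<Union>(U ` topspace Y)"
    by (auto simp: U_def)
  \<comment> \<open>The smallness is for the top chain, but all degrees are subdivided
    \<open>m\<close> times to keep the boundary relations.\<close>
  obtain m where m: "\<And>k f. \<lbrakk>m \<le> k; f \<in> Poly_Mapping.keys ((singular_subdivision K ^^ k) (d K))\<rbrakk>
      \<Longrightarrow> \<exists>V \<in> U ` topspace Y. f \<in> standard_simplex K \<rightarrow> V"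
  proof (rule sufficient_iterated_singular_subdivision_exists [OF _ U_cover d [OF order_refl]])
    show "openin Y V" if "V \<in> U ` topspace Y" for V
      using that U_open by auto
  qed (rule that)
  show False
  proof (rule no_orbit_chain_ladder [OF p, of K Y "\<lambda>j. (singular_subdivision j ^^ m) (d j)" T L])
    show "chain_eval (\<lambda>_. 1) ((singular_subdivision 0 ^^ m) (d 0)) = 1"
      using d0 subdivision_power_0 [OF d [of 0]] by simp
    show "chain_boundary (Suc j) ((singular_subdivision (Suc j) ^^ m) (d (Suc j)))
        = orbit_chain p T j ((singular_subdivision j ^^ m) (d j))" if "j < K" for j
      using chain_boundary_subdivision_power [OF d [of "Suc j"]] that bd
        subdivision_power_orbit_chain [OF d [of j]] by simp
    show "fst (L y) < K" if "y \<in> topspace Y" for y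
      using idx that by (simp add: L_def)
    fix \<sigma> x y
    assume \<sigma>: "\<sigma> \<in> Poly_Mapping.keys ((singular_subdivision K ^^ m) (d K))"
      and xy: "x \<in> \<sigma> ` standard_simplex K" "y \<in> \<sigma> ` standard_simplex K" "fst (L x) = fst (L y)"
    obtain z where z: "\<sigma> \<in> standard_simplex K \<rightarrow> U z"
      using m [OF order_refl \<sigma>] by blast
    then have U: "x \<in> U z" "y \<in> U z"
      using xy by auto
    then have Y: "x \<in> topspace Y" "y \<in> topspace Y"
      by (auto simp: U_def)
    have "z \<in> F (idx x) (rot x)" "z \<in> F (idx y) (rot y)"
      using U idx(1) [OF Y(1)] idx(1) [OF Y(2)] rot [OF Y(1)] rot [OF Y(2)]
      unfolding U_def by blast+
    then have "rot x = rot y"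
      using disj [OF idx(1) [OF Y(1)] rot(1) [OF Y(1)] rot(1) [OF Y(2)]] xy(3) by (auto simp: L_def)
    then show "snd (L x) = snd (L y)"
      by (simp add: L_def)
  qed (use d T L_T in \<open>auto intro: singular_chain_subdivision_power\<close>)
qed

section \<open>Cycles that bound, and boundaries of orbit chains\<close>

lemma chain_eval_one_chain_map:
  "chain_eval (\<lambda>_. 1) (chain_map n f c) = chain_eval (\<lambda>_. 1) c"
  by (simp add: chain_map_def chain_eval_extend)

text \<open>In degree 0 the image is the coefficient sum times a point, hence 0; in positive degrees
  cycles of a one-point space are boundaries.\<close>

lemma singular_relboundary_chain_map_const:
  assumes c: "singular_relcycle n X {} c" and "n = 0 \<Longrightarrow> chain_eval (\<lambda>_. 1) c = 0" and y: "y \<in> topspace Y"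
  shows "singular_relboundary n Y {} (chain_map n (\<lambda>_. y) c)"
proof (cases "n = 0")
  case True
  have "chain_map n (\<lambda>_. y) c = frag_cmul (chain_eval (\<lambda>_. 1) c) (frag_of (\<lambda>x\<in>standard_simplex n. y))"
    unfolding chain_map_def
    by (rule frag_induction [of c UNIV])
      (simp_all add: simplex_map_def o_def frag_extend_diff chain_eval_diff frag_cmul_diff_distrib)
  then show ?thesis
    using assms(2) True by simp
next
  case False
  have "continuous_map X (subtopology Y {y}) (\<lambda>_. y)"
    using y by simp
  then have "singular_relcycle n (subtopology Y {y}) {} (chain_map n (\<lambda>_. y) c)"
    using singular_relcycle_chain_map [OF c, of "subtopology Y {y}" "\<lambda>_. y" "{}"] by simp
  then have "singular_relboundary n (subtopology Y {y}) {} (chain_map n (\<lambda>_. y) c)"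
    using False y by (subst singular_boundary_eq_cycle_singleton [of _ y]) auto
  then show ?thesis
    unfolding singular_boundary using singular_chain_subtopology by blast
qed

text \<open>Reduced homology is the kernel of the map induced by collapsing \<open>X\<close> to a
  point; the condition on coefficient sums puts the class of \<open>c\<close> there in degree
  0.\<close>

lemma singular_relboundary_if_trivial_reduced_homology:
  assumes triv: "trivial_group (reduced_homology_group (int n) X)"
    and c: "singular_relcycle n X {} c" and eval: "n = 0 \<Longrightarrow> chain_eval (\<lambda>_. 1) c = 0"
  shows "singular_relboundary n X {} c"
proof -
  have "homologous_rel_set n X {} c \<in> carrier (homology_group (int n) X)"
    using c by (simp add: carrier_relative_homology_group)
  moreover have "hom_induced (int n) X {} (discrete_topology {()}) {} (\<lambda>x. ()) (homologous_rel_set n X {} c)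
      = singular_relboundary_set n (discrete_topology {()}) {}"
    using singular_relboundary_chain_map_const [OF c eval, of "()" "discrete_topology {()}"] c
    by (simp add: hom_induced_chain_map homologous_rel_set_eq_relboundary)
  ultimately have "homologous_rel_set n X {} c \<in> carrier (reduced_homology_group (int n) X)"
    by (simp add: carrier_reduced_homology_group kernel_def)
  then have "homologous_rel_set n X {} c = singular_relboundary_set n X {}"
    using triv by (auto simp: trivial_group_def one_reduced_homology_group)
  then show ?thesis
    by (simp add: homologous_rel_set_eq_relboundary)
qed

lemma singular_relboundary_nullhomotopic:
  assumes hom: "homotopic_with (\<lambda>_. True) X Y f (\<lambda>_. y)" and y: "y \<in> topspace Y"
    and c: "singular_relcycle n X {} c" and eval: "n = 0 \<Longrightarrow> chain_eval (\<lambda>_. 1) c = 0"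
  shows "singular_relboundary n Y {} (chain_map n f c)"
proof -
  have "homologous_rel n Y {} (chain_map n f c) (chain_map n (\<lambda>_. y) c)"
    by (rule homotopic_imp_homologous_rel_chain_maps [OF _ c]) (use hom in auto)
  then have "singular_relboundary n Y {} (chain_map n f c - chain_map n (\<lambda>_. y) c)"
    by (simp add: homologous_rel_def)
  from singular_relboundary_add [OF this singular_relboundary_chain_map_const [OF c eval y]]
  show ?thesis by simp
qed

text \<open>The product of \<open>1 - T\<close> and the sum of the powers of \<open>T\<close>
  telescopes to \<open>1 - T^p = 0\<close>. So the boundary prescribed for the next chain of the
  ladder is a cycle.\<close>

lemma chain_boundary_orbit_chain:
  assumes X: "continuous_map X X T" and per: "\<And>x. x \<in> topspace X \<Longrightarrow> (T ^^ p) x = x"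
    and c: "singular_chain (Suc n) X c" "singular_chain n X d"
    and bd: "chain_boundary (Suc n) c = orbit_chain p T n d"
  shows "chain_boundary (Suc n) (orbit_chain p T (Suc n) c) = 0"
proof -
  have shift: "chain_map n (T ^^ s) (chain_map n T d) = chain_map n (T ^^ Suc s) d" for s
    by (simp only: funpow_Suc_right chain_map_compose o_apply)
  have shift': "chain_map n T (chain_map n (T ^^ s) d) = chain_map n (T ^^ Suc s) d" for s
    by (simp only: funpow.simps(2) chain_map_compose o_apply)
  have Tp: "chain_map n (T ^^ p) d = d"
    by (rule chain_map_id_gen [OF c(2) per])
  have T0: "chain_map n (T ^^ 0) d = d"
    by (rule chain_map_id_gen [OF c(2)]) simp
  have telescope: "(\<Sum>s<p. chain_map n (T ^^ s) d - chain_map n (T ^^ Suc s) d) = 0"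
    unfolding sum_lessThan_telescope' [of "\<lambda>s. chain_map n (T ^^ s) d" p] Tp T0 by simp
  show ?thesis
  proof (cases "even n")
    case True
    have "chain_boundary (Suc n) (orbit_chain p T (Suc n) c)
        = (\<Sum>s<p. chain_map n (T ^^ s) (chain_boundary (Suc n) c))"
      using True by (simp add: orbit_chain_def chain_boundary_sum o_def chain_boundary_chain_map [OF c(1)])
    also have "\<dots> = (\<Sum>s<p. chain_map n (T ^^ s) d - chain_map n (T ^^ Suc s) d)"
      using True by (simp add: bd orbit_chain_def chain_map_diff shift del: funpow.simps)
    finally show ?thesis
      using telescope by simp
  next
    case False
    have "chain_boundary (Suc n) (orbit_chain p T (Suc n) c)
        = chain_boundary (Suc n) c - chain_map n T (chain_boundary (Suc n) c)"
      using False by (simp add: orbit_chain_def chain_boundary_diff chain_boundary_chain_map [OF c(1)])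
    also have "\<dots> = (\<Sum>s<p. chain_map n (T ^^ s) d - chain_map n (T ^^ Suc s) d)"
      using False by (simp add: bd orbit_chain_def chain_map_sum o_def shift' sum_subtractf del: funpow.simps)
    finally show ?thesis
      using telescope by simp
  qed
qed

lemma singular_chain_orbit_chain:
  assumes "continuous_map X X T" "singular_chain n X c"
  shows "singular_chain n X (orbit_chain p T n c)"
proof -
  have "continuous_map X X (T ^^ s)" for s
    by (induction s) (use assms in \<open>auto simp: id_def intro: continuous_map_compose [unfolded o_def]\<close>)
  then show ?thesis
    using assms
    by (auto simp: orbit_chain_def intro!: singular_chain_diff singular_chain_sum
        intro: singular_chain_chain_map)
qed

lemma chain_map_orbit_chain:
  assumes c: "singular_chain n X c" and S: "\<And>x. x \<in> topspace X \<Longrightarrow> S x \<in> topspace X"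
    and f: "\<And>x. x \<in> topspace X \<Longrightarrow> f (S x) = T (f x)"
  shows "chain_map n f (orbit_chain p S n c) = orbit_chain p T n (chain_map n f c)"
proof -
  have S_pow: "(S ^^ s) x \<in> topspace X \<and> f ((S ^^ s) x) = (T ^^ s) (f x)" if "x \<in> topspace X" for s x
    using that S f by (induction s) auto
  have "chain_map n f (chain_map n (S ^^ s) c) = chain_map n (T ^^ s) (chain_map n f c)" for s
  proof -
    have "chain_map n (f \<circ> (S ^^ s)) c = chain_map n ((T ^^ s) \<circ> f) c"
      by (rule chain_map_eq [OF c]) (use S_pow in auto)
    then show ?thesis
      by (simp add: chain_map_compose)
  qed
  from this this [of 1] show ?thesis
    by (simp add: orbit_chain_def chain_map_diff chain_map_sum o_def)
qed

text \<open>The ladder is built in \<open>X\<close> up to degree \<open>K - 1\<close> and pushed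
  forward by \<open>f\<close>; only its last chain is constructed in \<open>Y\<close>.\<close>

theorem equivariant_map_not_nullhomotopic:
  assumes p: "2 \<le> p" and "0 < K"
    and S: "continuous_map X X S" and S_pow: "\<And>x. x \<in> topspace X \<Longrightarrow> (S ^^ p) x = x"
    and triv: "\<And>n. Suc n < K \<Longrightarrow> trivial_group (reduced_homology_group (int n) X)"
    and "topspace X \<noteq> {}"
    and f: "continuous_map X Y f" and f_S: "\<And>x. x \<in> topspace X \<Longrightarrow> f (S x) = T (f x)"
    and T: "\<And>y. y \<in> topspace Y \<Longrightarrow> T y \<in> topspace Y"
    and F: "\<And>i r. i < K \<Longrightarrow> r < p \<Longrightarrow> closedin Y (F i r)"
    and cover: "\<And>y. y \<in> topspace Y \<Longrightarrow> \<exists>i<K. \<exists>r<p. y \<in> F i r"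
    and disj: "\<And>i r s. \<lbrakk>i < K; r < p; s < p; r \<noteq> s\<rbrakk> \<Longrightarrow> F i r \<inter> F i s = {}"
    and F_T: "\<And>i r y. \<lbrakk>i < K; r < p; y \<in> topspace Y\<rbrakk> \<Longrightarrow> T y \<in> F i (Suc r mod p) \<longleftrightarrow> y \<in> F i r"
    and y: "y \<in> topspace Y"
  shows "\<not> homotopic_with (\<lambda>_. True) X Y f (\<lambda>_. y)"
proof
  assume hom: "homotopic_with (\<lambda>_. True) X Y f (\<lambda>_. y)"
  obtain x where x: "x \<in> topspace X"
    using \<open>topspace X \<noteq> {}\<close> by blast
  \<comment> \<open>The recursion is total, but the choices are known to be meaningful only in
    degrees below \<open>K\<close>, by the induction that follows.\<close>
  define c where "c = rec_nat (frag_of (\<lambda>_\<in>standard_simplex 0. x))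
      (\<lambda>j d. SOME e. singular_chain (Suc j) X e \<and> chain_boundary (Suc j) e = orbit_chain p S j d)"
  have c_Suc: "c (Suc j) = (SOME e. singular_chain (Suc j) X e \<and> chain_boundary (Suc j) e = orbit_chain p S j (c j))" for j
    by (simp add: c_def)
  have c_0: "singular_chain 0 X (c 0)" "chain_eval (\<lambda>_. 1) (c 0) = 1"
    using x by (auto simp: c_def singular_chain_of singular_simplex_def)
  have cycle0: "singular_relcycle 0 X {} (orbit_chain p S 0 (c 0))"
    "chain_eval (\<lambda>_. 1) (orbit_chain p S 0 (c 0)) = 0"
    using singular_chain_orbit_chain [OF S c_0(1), of p]
    by (auto simp: singular_cycle chain_boundary_def orbit_chain_def chain_eval_diff chain_eval_one_chain_map)
  have c: "singular_chain j X (c j) \<and> singular_relcycle j X {} (orbit_chain p S j (c j)) \<and>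
      (0 < j \<longrightarrow> chain_boundary j (c j) = orbit_chain p S (j - 1) (c (j - 1)))" if "j < K" for j
    using that
  proof (induction j)
    case 0
    then show ?case
      using c_0 cycle0 by simp
  next
    case (Suc j)
    then have IH: "singular_chain j X (c j)" "singular_relcycle j X {} (orbit_chain p S j (c j))"
      by auto
    have "singular_relboundary j X {} (orbit_chain p S j (c j))"
      using Suc.prems IH(2) cycle0(2)
      by (intro singular_relboundary_if_trivial_reduced_homology triv) auto
    then have "\<exists>e. singular_chain (Suc j) X e \<and> chain_boundary (Suc j) e = orbit_chain p S j (c j)"
      by (simp add: singular_boundary)
    then have "singular_chain (Suc j) X (c (Suc j)) \<and> chain_boundary (Suc j) (c (Suc j)) = orbit_chain p S j (c j)"
      unfolding c_Suc by (rule someI_ex)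
    then have e: "singular_chain (Suc j) X (c (Suc j))" "chain_boundary (Suc j) (c (Suc j)) = orbit_chain p S j (c j)"
      by auto
    moreover have "singular_relcycle (Suc j) X {} (orbit_chain p S (Suc j) (c (Suc j)))"
      using singular_chain_orbit_chain [OF S e(1), of p] chain_boundary_orbit_chain [OF S S_pow e(1) IH(1) e(2)]
      by (simp add: singular_cycle)
    ultimately show ?case
      by simp
  qed
  \<comment> \<open>Degree \<open>K - 1\<close> is beyond the range of \<open>triv\<close>; the
    nullhomotopy of \<open>f\<close> makes the image of the cycle bound in \<open>Y\<close>
    instead.\<close>
  have "singular_relboundary (K - 1) Y {} (chain_map (K - 1) f (orbit_chain p S (K - 1) (c (K - 1))))"
    using c [of "K - 1"] \<open>0 < K\<close> cycle0(2)
    by (intro singular_relboundary_nullhomotopic [OF hom y]) auto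
  then obtain e where e: "singular_chain K Y e"
      "chain_boundary K e = chain_map (K - 1) f (orbit_chain p S (K - 1) (c (K - 1)))"
    using \<open>0 < K\<close> by (auto simp: singular_boundary)
  have push: "chain_map j f (orbit_chain p S j (c j)) = orbit_chain p T j (chain_map j f (c j))" if "j < K" for j
    using c [OF that] S f_S by (intro chain_map_orbit_chain) (auto simp: continuous_map_def)
  show False
  proof (rule no_orbit_chain_ladder_closed_cover [OF p, of K Y "\<lambda>j. if j < K then chain_map j f (c j) else e" T F])
    fix j assume "j \<le> K"
    then show "singular_chain j Y (if j < K then chain_map j f (c j) else e)"
      using c [of j] e f by (auto intro: singular_chain_chain_map)
  next
    fix j assume j: "j < K"
    show "chain_boundary (Suc j) (if Suc j < K then chain_map (Suc j) f (c (Suc j)) else e)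
        = orbit_chain p T j (if j < K then chain_map j f (c j) else e)"
    proof (cases "Suc j < K")
      case True
      then show ?thesis
        using c [OF True] push [OF j] chain_boundary_chain_map [of "Suc j" X "c (Suc j)" f] j by simp
    next
      case False
      then have "K = Suc j" using j by simp
      then show ?thesis
        using e push [OF j] by simp
    qed
  qed (use \<open>0 < K\<close> c_0 T F cover disj F_T in \<open>auto simp: chain_eval_one_chain_map\<close>)
qed

section \<open>Cyclically permuted closed covers\<close>

text \<open>The condition on the target space in \<open>equivariant_map_not_nullhomotopic\<close>;
  the number \<open>K\<close> of rows is the degree in which the label cochains vanish.\<close>

definition rotation_cover ::
    "'b topology \<Rightarrow> ('b \<Rightarrow> 'b) \<Rightarrow> nat \<Rightarrow> nat \<Rightarrow> (nat \<Rightarrow> nat \<Rightarrow> 'b set) \<Rightarrow> bool" where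
  "rotation_cover Y T p K F \<longleftrightarrow>
     (\<forall>i<K. \<forall>r<p. closedin Y (F i r)) \<and>
     (\<forall>y\<in>topspace Y. \<exists>i<K. \<exists>r<p. y \<in> F i r) \<and>
     (\<forall>i<K. \<forall>r<p. \<forall>s<p. r \<noteq> s \<longrightarrow> F i r \<inter> F i s = {}) \<and>
     (\<forall>i<K. \<forall>r<p. \<forall>y\<in>topspace Y. T y \<in> F i (Suc r mod p) \<longleftrightarrow> y \<in> F i r)"

text \<open>A point is classified by a coordinate of largest norm, nonzero for
  \<open>y \<noteq> 0\<close>, and by the set of that coordinate's cover containing its value. The
  maps \<open>S i\<close> preserve norms, so \<open>T\<close> preserves which coordinates are
  largest.\<close>

lemma rotation_cover_dominant_coordinate:
  fixes \<zeta> :: "'i::finite \<Rightarrow> 'b::real_normed_vector \<Rightarrow> 'c::real_normed_vector"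
  assumes cont: "\<And>i. continuous_on UNIV (\<zeta> i)"
    and zero: "\<And>y. (\<And>i. \<zeta> i y = 0) \<Longrightarrow> y = 0"
    and T: "\<And>y. y \<noteq> 0 \<Longrightarrow> T y \<noteq> 0" "\<And>i y. \<zeta> i (T y) = S i (\<zeta> i y)"
    and S: "\<And>i x. norm (S i x) = norm x"
    and E: "\<And>i. \<exists>E. rotation_cover (top_of_set (- {0})) (S i) p D E"
  shows "\<exists>F. rotation_cover (top_of_set (- {0})) T p (CARD('i) * D) F"
proof -
  obtain E where E: "\<And>i. rotation_cover (top_of_set (- {0})) (S i) p D (E i)"
    using E by metis
  obtain e :: "nat \<Rightarrow> 'i" where e: "bij_betw e {0..<CARD('i)} UNIV"
    using ex_bij_betw_nat_finite [of "UNIV :: 'i set"] by auto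
  \<comment> \<open>The row \<open>k = m * D + s\<close> stands for row \<open>s\<close> in the
    cover of coordinate \<open>e m\<close>.\<close>
  define F where "F k r = {y. y \<noteq> 0 \<and> (\<forall>j. norm (\<zeta> j y) \<le> norm (\<zeta> (e (k div D)) y)) \<and>
      \<zeta> (e (k div D)) y \<in> E (e (k div D)) (k mod D) r}" for k r
  have nonzero: "\<zeta> i y \<noteq> 0" if "y \<noteq> 0" "\<And>j. norm (\<zeta> j y) \<le> norm (\<zeta> i y)" for i y
    using that zero [of y] by (metis norm_le_zero_iff norm_zero)
  have mod: "k mod D < D" if "k < CARD('i) * D" for k
    using that by (metis mod_less_divisor mult_is_0 not_gr_zero not_less_zero)
  have closed: "closedin (top_of_set (- {0})) (F k r)" if k: "k < CARD('i) * D" and "r < p" for k r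
  proof -
    let ?i = "e (k div D)"
    have "closedin (top_of_set (- {0})) (E ?i (k mod D) r)"
      using E [of ?i] mod [OF k] \<open>r < p\<close> by (simp add: rotation_cover_def)
    then obtain C where C: "closed C" "E ?i (k mod D) r = - {0} \<inter> C"
      by (auto simp: closedin_closed)
    have "F k r = - {0} \<inter> ((\<Inter>j. {y. norm (\<zeta> j y) \<le> norm (\<zeta> ?i y)}) \<inter> \<zeta> ?i -` C)"
      using nonzero by (auto simp: F_def C(2))
    moreover have "closed ((\<Inter>j. {y. norm (\<zeta> j y) \<le> norm (\<zeta> ?i y)}) \<inter> \<zeta> ?i -` C)"
      using cont C(1)
      by (intro closed_Int closed_INT ballI closed_Collect_le continuous_intros closed_vimage) auto
    ultimately show ?thesis
      by (auto simp: closedin_closed)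
  qed
  have cover: "\<exists>k<CARD('i) * D. \<exists>r<p. y \<in> F k r" if y: "y \<noteq> 0" for y
  proof -
    have "Max (range (\<lambda>j. norm (\<zeta> j y))) \<in> range (\<lambda>j. norm (\<zeta> j y))"
      by (rule Max_in) auto
    then obtain i where "Max (range (\<lambda>j. norm (\<zeta> j y))) = norm (\<zeta> i y)"
      by blast
    then have i: "norm (\<zeta> j y) \<le> norm (\<zeta> i y)" for j
      by (metis Max_ge finite_code finite_imageI rangeI)
    have "\<zeta> i y \<in> - {0}"
      using nonzero [OF y i] by simp
    then have "\<exists>s<D. \<exists>r<p. \<zeta> i y \<in> E i s r"
      using E [of i] unfolding rotation_cover_def topspace_euclidean_subtopology by (elim conjE) (rule bspec)
    then obtain s r where sr: "s < D" "r < p" "\<zeta> i y \<in> E i s r"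
      by (elim exE conjE)
    obtain m where m: "m < CARD('i)" "e m = i"
      using bij_betw_imp_surj_on [OF e] by (metis UNIV_I atLeastLessThan_iff imageE)
    have "m * D + s < Suc m * D"
      using sr by simp
    also have "\<dots> \<le> CARD('i) * D"
      using m by (intro mult_right_mono) auto
    finally have "m * D + s < CARD('i) * D" .
    moreover have "y \<in> F (m * D + s) r"
      using sr m y i by (simp add: F_def)
    ultimately show ?thesis
      using sr by blast
  qed
  have disj: "F k r \<inter> F k s = {}" if "k < CARD('i) * D" "r < p" "s < p" "r \<noteq> s" for k r s
    using E [of "e (k div D)"] mod that by (fastforce simp: F_def rotation_cover_def)
  have equiv: "T y \<in> F k (Suc r mod p) \<longleftrightarrow> y \<in> F k r"
    if k: "k < CARD('i) * D" and r: "r < p" and y: "y \<noteq> 0" for k r y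
  proof -
    let ?i = "e (k div D)"
    have "S ?i (\<zeta> ?i y) \<in> E ?i (k mod D) (Suc r mod p) \<longleftrightarrow> \<zeta> ?i y \<in> E ?i (k mod D) r"
      if "\<And>j. norm (\<zeta> j y) \<le> norm (\<zeta> ?i y)"
      using E [of ?i] mod [OF k] r nonzero [OF y that] by (simp add: rotation_cover_def)
    then show ?thesis
      using y T(1) [OF y] by (auto simp: F_def T(2) S)
  qed
  show ?thesis
    unfolding rotation_cover_def
    by (rule exI [of _ F]) (use closed cover disj equiv in simp)
qed

section \<open>Covers for the real, complex and quaternionic scalars\<close>

definition primitive_root :: "'a::monoid_mult \<Rightarrow> nat \<Rightarrow> bool" where
  "primitive_root q p \<longleftrightarrow> 2 \<le> p \<and> q ^ p = 1 \<and> (\<forall>j. 0 < j \<longrightarrow> j < p \<longrightarrow> q ^ j \<noteq> 1)"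

lemma primitive_root_power_mod:
  assumes "primitive_root q p"
  shows "q ^ (k mod p) = q ^ k"
proof -
  have "q ^ k = (q ^ p) ^ (k div p) * q ^ (k mod p)"
    by (simp flip: power_mult power_add)
  then show ?thesis
    using assms by (simp add: primitive_root_def)
qed

lemma primitive_root_inj_on:
  fixes q :: "'a::division_ring"
  assumes "primitive_root q p"
  shows "inj_on (\<lambda>r. q ^ r) {..<p}"
proof (rule linorder_inj_onI')
  have "q \<noteq> 0"
    using assms by (auto simp: primitive_root_def power_0_left)
  fix i j :: nat assume ij: "i \<in> {..<p}" "j \<in> {..<p}" "i < j"
  then have "q ^ j = q ^ i * q ^ (j - i)"
    by (simp flip: power_add)
  moreover have "q ^ (j - i) \<noteq> 1"
    using assms ij by (auto simp: primitive_root_def)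
  ultimately show "q ^ i \<noteq> q ^ j"
    using \<open>q \<noteq> 0\<close> by simp
qed

text \<open>The only case is \<open>q = -1\<close> and \<open>p = 2\<close>: the two open half lines
  are closed in the punctured line and are exchanged.\<close>

lemma rotation_cover_real:
  assumes "primitive_root (q :: real) p"
  shows "\<exists>E. rotation_cover (top_of_set (- {0})) ((*) q) p 1 E"
proof -
  have p: "2 \<le> p" "q ^ p = 1" "\<And>j. 0 < j \<Longrightarrow> j < p \<Longrightarrow> q ^ j \<noteq> 1"
    using assms by (auto simp: primitive_root_def)
  have "\<bar>q\<bar> = 1"
    using p(1) power_eq_1_iff [OF p(2)] by simp
  then have q: "q = -1"
    using p(1) p(3) [of 1] by auto
  then have "p = 2"
    using p(1) p(3) [of 2] by fastforce
  define E where "E i r = (if r = 0 then {0<..} else {..<(0::real)})" for i r :: nat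
  have "{0<..} = - {0} \<inter> {0::real..}" "{..<0} = - {0} \<inter> {..0::real}"
    by auto
  then have "closedin (top_of_set (- {0})) {0::real<..}" "closedin (top_of_set (- {0})) {..<0::real}"
    unfolding closedin_closed using closed_atLeast closed_atMost by blast+
  then have "closedin (top_of_set (- {0})) (E i r)" for i r
    by (simp add: E_def)
  moreover have "\<exists>r<2. y \<in> E 0 r" if "y \<noteq> 0" for y
    using that by (intro exI [of _ "if 0 < y then 0 else 1"]) (simp add: E_def)
  moreover have "E i r \<inter> E i s = {}" if "r < 2" "s < 2" "r \<noteq> s" for i r s
    using that by (auto simp: E_def less_2_cases_iff)
  moreover have "- y \<in> E i (Suc r mod 2) \<longleftrightarrow> y \<in> E i r" if "r < 2" for i r y
    using that by (auto simp: E_def less_2_cases_iff)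
  ultimately show ?thesis
    unfolding rotation_cover_def \<open>p = 2\<close> q
    by (intro exI [of _ E]) simp
qed

lemma rotation_cover_complex:
  assumes q: "primitive_root (q :: complex) p"
  shows "\<exists>E. rotation_cover (top_of_set (- {0})) ((*) q) p 2 E"
proof -
  have p: "0 < p" "q ^ p = 1"
    using q by (auto simp: primitive_root_def)
  have inj: "inj_on (\<lambda>r. q ^ r) {..<p}"
    by (rule primitive_root_inj_on [OF q])
  \<comment> \<open>By counting: the powers of \<open>q\<close> are \<open>p\<close> distinct roots
    of unity, and there are exactly \<open>p\<close>.\<close>
  have roots: "\<exists>r<p. z = q ^ r" if "z ^ p = 1" for z
  proof -
    have "(\<lambda>r. q ^ r) ` {..<p} = {z. z ^ p = 1}"
    proof (rule card_subset_eq)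
      show "finite {z::complex. z ^ p = 1}"
        using p by (intro finite_roots_unity) auto
      show "(\<lambda>r. q ^ r) ` {..<p} \<subseteq> {z. z ^ p = 1}"
        using p by (auto simp flip: power_mult) (metis mult.commute power_mult power_one)
      show "card ((\<lambda>r. q ^ r) ` {..<p}) = card {z::complex. z ^ p = 1}"
        using p card_image [OF inj] card_roots_unity_eq [of p] by simp
    qed
    then show ?thesis
      using that by auto
  qed
  define \<epsilon> :: "nat \<Rightarrow> complex" where "\<epsilon> s = (if s = 0 then 1 else -1)" for s
  \<comment> \<open>A \<open>p\<close>-th root of the sign \<open>\<epsilon> s\<close>; in
    \<open>\<rho>\<close> it compensates for the sign inside \<open>Ln\<close>.\<close>
  define \<eta> :: "nat \<Rightarrow> complex" where "\<eta> s = (if s = 0 then 1 else cis (pi / p))" for s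
  define \<rho> where "\<rho> s w = exp (Ln (\<epsilon> s * w) / p) * \<eta> s" for s w
  have \<eta>: "\<eta> s ^ p = \<epsilon> s" for s
    using p by (simp add: \<eta>_def \<epsilon>_def Complex.DeMoivre)
  have \<epsilon>: "\<epsilon> s * \<epsilon> s = 1" "\<epsilon> s \<noteq> 0" for s
    by (auto simp: \<epsilon>_def)
  have \<rho>: "\<rho> s w ^ p = w" if "w \<noteq> 0" for s w
  proof -
    have "exp (Ln (\<epsilon> s * w) / p) ^ p = \<epsilon> s * w"
      using p that \<epsilon> by (simp flip: exp_of_nat_mult)
    then show ?thesis
      using \<epsilon> [of s] by (simp add: \<rho>_def power_mult_distrib \<eta>)
  qed
  \<comment> \<open>On each of the half planes \<open>0 \<le> Re w\<close> and \<open>Re w \<le> 0\<close> a \<open>p\<close>-th root \<open>\<rho> s w\<close> can be chosen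
    continuously, and \<open>x\<close> differs from the root of \<open>x ^ p\<close> by a unique power of \<open>q\<close>.\<close>
  define E where "E s r = {x. x \<noteq> 0 \<and> 0 \<le> Re (\<epsilon> s * x ^ p) \<and> x = q ^ r * \<rho> s (x ^ p)}" for s r
  have "closedin (top_of_set (- {0})) (E s r)" for s r
  proof -
    let ?Z = "- {0} \<inter> {x. 0 \<le> Re (\<epsilon> s * x ^ p)}"
    have "closed {x. 0 \<le> Re (\<epsilon> s * x ^ p)}"
      by (intro closed_Collect_le continuous_intros)
    then have Z: "closedin (top_of_set (- {0})) ?Z"
      by (auto simp: closedin_closed)
    \<comment> \<open>Away from 0 the closed right half plane misses the branch cut of
      \<open>Ln\<close>, so the root is continuous up to the imaginary axis.\<close>
    have "w \<notin> \<real>\<^sub>\<le>\<^sub>0" if "0 \<le> Re w" "w \<noteq> 0" for w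
      using that by (auto simp: complex_nonpos_Reals_iff complex_eq_iff)
    then have "\<epsilon> s * x ^ p \<notin> \<real>\<^sub>\<le>\<^sub>0" if "x \<in> ?Z" for x
      using that \<epsilon>(2) [of s] by auto
    then have "continuous_on ?Z (\<lambda>x. x - q ^ r * \<rho> s (x ^ p))"
      unfolding \<rho>_def using p by (intro continuous_intros) auto
    then have "closedin (top_of_set ?Z) {x \<in> ?Z. x - q ^ r * \<rho> s (x ^ p) = 0}"
      by (rule continuous_closedin_preimage_constant)
    moreover have "{x \<in> ?Z. x - q ^ r * \<rho> s (x ^ p) = 0} = E s r"
      by (auto simp: E_def)
    ultimately show ?thesis
      using Z by (metis closedin_trans)
  qed
  moreover have "\<exists>s<2. \<exists>r<p. x \<in> E s r" if x: "x \<noteq> 0" for x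
  proof -
    obtain s where s: "s < 2" "0 \<le> Re (\<epsilon> s * x ^ p)"
    proof (cases "0 \<le> Re (x ^ p)")
      case True
      then show ?thesis using that [of 0] by (simp add: \<epsilon>_def)
    next
      case False
      then show ?thesis using that [of 1] by (simp add: \<epsilon>_def)
    qed
    have "\<rho> s (x ^ p) \<noteq> 0" "(x / \<rho> s (x ^ p)) ^ p = 1"
      using x p \<rho> [of "x ^ p" s] by (auto simp: power_divide power_0_left)
    then obtain r where "r < p" "x = q ^ r * \<rho> s (x ^ p)"
      using roots by (metis nonzero_eq_divide_eq)
    then show ?thesis
      using x s by (auto simp: E_def)
  qed
  moreover have "E s r \<inter> E s r' = {}" if "r < p" "r' < p" "r \<noteq> r'" for s r r'
  proof -
    have "q ^ r \<noteq> q ^ r'"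
      using inj_onD [OF inj, of r r'] that by auto
    moreover have "q ^ r = q ^ r'" if "x \<in> E s r" "x \<in> E s r'" for x
    proof -
      have "\<rho> s (x ^ p) \<noteq> 0"
        using \<rho> [of "x ^ p" s] that p by (auto simp: power_0_left E_def)
      moreover have "q ^ r * \<rho> s (x ^ p) = q ^ r' * \<rho> s (x ^ p)"
        using that by (simp add: E_def)
      ultimately show ?thesis
        by (simp only: mult_cancel_right) simp
    qed
    ultimately show ?thesis
      by blast
  qed
  \<comment> \<open>Since \<open>(q * x) ^ p = x ^ p\<close>, the chosen root is unchanged and only
    the exponent of \<open>q\<close> increases.\<close>
  moreover have "q * x \<in> E s (Suc r mod p) \<longleftrightarrow> x \<in> E s r" for s r x
  proof -
    have "q \<noteq> 0"
      using p by (auto simp: power_0_left)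
    then show ?thesis
      by (simp add: E_def primitive_root_power_mod [OF q] power_mult_distrib p(2))
  qed
  ultimately show ?thesis
    unfolding rotation_cover_def by (intro exI [of _ E]) auto
qed

lemma continuous_on_quat_sel [continuous_intros]:
  fixes f :: "_ \<Rightarrow> quat"
  assumes "continuous_on A f"
  shows "continuous_on A (\<lambda>x. q_re (f x))" "continuous_on A (\<lambda>x. q_i (f x))"
    "continuous_on A (\<lambda>x. q_j (f x))" "continuous_on A (\<lambda>x. q_k (f x))"
proof -
  have "q_re x = x \<bullet> Quat 1 0 0 0" "q_i x = x \<bullet> Quat 0 1 0 0"
    "q_j x = x \<bullet> Quat 0 0 1 0" "q_k x = x \<bullet> Quat 0 0 0 1" for x
    by (simp_all add: inner_quat_def)
  then show "continuous_on A (\<lambda>x. q_re (f x))" "continuous_on A (\<lambda>x. q_i (f x))"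
    "continuous_on A (\<lambda>x. q_j (f x))" "continuous_on A (\<lambda>x. q_k (f x))"
    using assms by (auto intro!: continuous_intros)
qed

definition quat_of_complex :: "complex \<Rightarrow> quat" where
  "quat_of_complex c = Quat (Re c) (Im c) 0 0"

lemma quat_of_complex_mult: "quat_of_complex (c * d) = quat_of_complex c * quat_of_complex d"
  by (simp add: quat_of_complex_def quat_eq_iff)

lemma quat_of_complex_eq_1_iff: "quat_of_complex c = 1 \<longleftrightarrow> c = 1"
  by (auto simp: quat_of_complex_def quat_eq_iff complex_eq_iff)

lemma unit_quat_conjugate_complex:
  assumes "norm q = 1"
  obtains \<omega> z where "norm \<omega> = 1" "z \<noteq> 0" "q * z = z * quat_of_complex \<omega>"
proof -
  define s where "s = sqrt ((q_i q)\<^sup>2 + (q_j q)\<^sup>2 + (q_k q)\<^sup>2)"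
  have s: "s * s = q_i q * q_i q + q_j q * q_j q + q_k q * q_k q"
    by (simp add: s_def power2_eq_square)
  have norm: "norm (Complex (q_re q) s) = 1"
    using assms norm_quat_sq [of q] by (simp add: cmod_def s_def add.assoc)
  show thesis
  proof (cases "q_j q = 0 \<and> q_k q = 0 \<and> q_i q + s = 0")
    \<comment> \<open>Here \<open>q\<close> is \<open>q_re q - s i\<close> and the general formula
      would give \<open>z = 0\<close>; the quaternion \<open>j\<close> anticommutes with
      \<open>i\<close> and serves instead.\<close>
    case True
    then have "q * Quat 0 0 1 0 = Quat 0 0 1 0 * quat_of_complex (Complex (q_re q) s)"
      by (simp add: quat_eq_iff quat_of_complex_def)
    moreover have "Quat 0 0 1 0 \<noteq> 0"
      by (simp add: quat_eq_iff)
    ultimately show thesis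
      using that norm by blast
  next
    case False
    \<comment> \<open>For \<open>v = Im q\<close> and \<open>s = norm v\<close>, the element \<open>z = v + s i\<close> satisfies \<open>v z = z s i\<close> as \<open>v\<^sup>2 = - s\<^sup>2\<close>.\<close>
    define z where "z = Quat 0 (q_i q + s) (q_j q) (q_k q)"
    have "z \<noteq> 0"
      using False by (auto simp: z_def quat_eq_iff)
    moreover have "q * z = z * quat_of_complex (Complex (q_re q) s)"
      using s by (simp add: z_def quat_eq_iff quat_of_complex_def algebra_simps)
    ultimately show thesis
      using that norm by blast
  qed
qed

text \<open>Write \<open>q = z \<omega> z^(-1)\<close> with \<open>\<omega>\<close> complex of the
  same order. In the variable \<open>inverse z * x\<close>, multiplication by \<open>q\<close>
  becomes multiplication by \<open>\<omega>\<close> on the two complex coordinates for the bases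
  \<open>1, i\<close> and \<open>j, k\<close>, each with 2 rows.\<close>

lemma rotation_cover_quat:
  assumes q: "primitive_root (q :: quat) p" "norm q = 1"
  shows "\<exists>E. rotation_cover (top_of_set (- {0})) ((*) q) p 4 E"
proof -
  obtain \<omega> z where \<omega>: "norm \<omega> = 1" and z: "z \<noteq> 0" "q * z = z * quat_of_complex \<omega>"
    using unit_quat_conjugate_complex [OF q(2)] .
  have pow: "q ^ j * z = z * quat_of_complex (\<omega> ^ j)" for j
  proof (induction j)
    case 0
    have "quat_of_complex 1 = 1" by (simp add: quat_of_complex_eq_1_iff)
    then show ?case by simp
  next
    case (Suc j)
    have "q ^ Suc j * z = q * (q ^ j * z)"
      by (simp add: mult.assoc)
    also have "\<dots> = z * quat_of_complex \<omega> * quat_of_complex (\<omega> ^ j)"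
      unfolding Suc.IH by (simp only: z(2) flip: mult.assoc)
    finally show ?case
      by (simp add: quat_of_complex_mult mult.assoc)
  qed
  have "q ^ j = 1 \<longleftrightarrow> \<omega> ^ j = 1" for j
  proof -
    have "q ^ j = 1 \<longleftrightarrow> q ^ j * z = 1 * z"
      using z(1) by (simp only: mult_cancel_right) simp
    also have "\<dots> \<longleftrightarrow> z * quat_of_complex (\<omega> ^ j) = z * 1"
      by (simp add: pow)
    also have "\<dots> \<longleftrightarrow> \<omega> ^ j = 1"
      using z(1) by (simp only: mult_cancel_left) (simp add: quat_of_complex_eq_1_iff)
    finally show ?thesis .
  qed
  then have "primitive_root \<omega> p"
    using q(1) by (simp add: primitive_root_def)
  then have E: "\<exists>E. rotation_cover (top_of_set (- {0})) ((*) \<omega>) p 2 E"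
    by (rule rotation_cover_complex)
  define \<zeta> where "\<zeta> b x = (let y = inverse z * x in
      if b then Complex (q_re y) (q_i y) else Complex (q_j y) (q_k y))" for b x
  have inv: "inverse z * (q * x) = quat_of_complex \<omega> * (inverse z * x)" for x
  proof -
    have "q = z * quat_of_complex \<omega> * inverse z"
      using z by (metis mult.assoc mult.right_neutral right_inverse)
    then have "inverse z * (q * x) = (inverse z * z) * (quat_of_complex \<omega> * (inverse z * x))"
      by (simp only: mult.assoc)
    then show ?thesis
      using z(1) by simp
  qed
  have "\<exists>F. rotation_cover (top_of_set (- {0})) ((*) q) p (CARD(bool) * 2) F"
  proof (rule rotation_cover_dominant_coordinate [of \<zeta> _ "\<lambda>_. (*) \<omega>"])
    show "continuous_on UNIV (\<zeta> b)" for b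
      by (cases b) (auto simp: \<zeta>_def Let_def complex_eq_iff intro!: continuous_intros continuous_on_Complex)
    show "y = 0" if "\<And>b. \<zeta> b y = 0" for y
    proof -
      have "inverse z * y = 0"
        using that [of True] that [of False] by (simp add: \<zeta>_def Let_def quat_eq_iff complex_eq_iff del: mult_eq_0_iff)
      then show ?thesis
        using z(1) by simp
    qed
    show "\<zeta> b (q * y) = \<omega> * \<zeta> b y" for b y
      unfolding \<zeta>_def Let_def inv
      by (simp add: quat_of_complex_def complex_eq_iff)
  qed (use \<omega> q(2) E in \<open>auto simp: norm_mult\<close>)
  then show ?thesis
    by simp
qed

lemma rotation_cover_vec:
  fixes q :: "'n::finite \<Rightarrow> 'a::real_normed_div_algebra"
  assumes "\<And>i. norm (q i) = 1"
    and "\<And>i. \<exists>E. rotation_cover (top_of_set (- {0})) ((*) (q i)) p D E"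
  shows "\<exists>F. rotation_cover (top_of_set (- {0 :: 'a ^ 'n})) (\<lambda>y. \<chi> i. q i * y $ i) p (CARD('n) * D) F"
proof (rule rotation_cover_dominant_coordinate [of "\<lambda>i y. y $ i" _ "\<lambda>i. (*) (q i)"])
  show "(\<chi> i. q i * y $ i) \<noteq> 0" if "y \<noteq> 0" for y
  proof -
    have "q i \<noteq> 0" for i
      using assms(1) [of i] by auto
    then show ?thesis
      using that by (auto simp: vec_eq_iff)
  qed
  show "continuous_on UNIV (\<lambda>y :: 'a ^ 'n. y $ i)" for i
    by (intro continuous_intros)
  show "\<exists>E. rotation_cover (top_of_set (- {0})) ((*) (q i)) p D E" for i
    by (rule assms(2))
qed (simp_all add: vec_eq_iff norm_mult assms(1))

section \<open>Continuity of vector-valued measures\<close>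

lemma trivial_reduced_homology_group_sphere:
  assumes "Suc n < DIM('v::euclidean_space)"
  shows "trivial_group (reduced_homology_group (int n) (top_of_set (sphere 0 1 :: 'v set)))"
proof -
  obtain f :: "(nat \<Rightarrow> real) \<Rightarrow> 'v" and g
    where "homeomorphic_maps (nsphere (DIM('v) - 1)) (top_of_set (sphere 0 1 \<inter> span (Basis :: 'v set))) f g"
    using homeomorphic_maps_nsphere_euclidean_sphere
      [of "Basis :: 'v set", OF independent_Basis orthogonal_Basis refl _ norm_Basis] by auto
  then have "nsphere (DIM('v) - 1) homeomorphic_space top_of_set (sphere 0 1 :: 'v set)"
    by (auto simp: homeomorphic_space_def)
  then have "reduced_homology_group (int n) (nsphere (DIM('v) - 1))
      \<cong> reduced_homology_group (int n) (top_of_set (sphere 0 1 :: 'v set))"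
    by (rule homeomorphic_space_imp_isomorphic_reduced_homology_groups)
  moreover have "trivial_group (reduced_homology_group (int n) (nsphere (DIM('v) - 1)))"
    using assms by (subst trivial_reduced_homology_group_nsphere) auto
  ultimately show ?thesis
    by (rule isomorphic_group_triviality1 [OF _ group_reduced_homology_group])
qed

section \<open>Countably additive vector measures\<close>

locale vector_measure =
  fixes M :: "'x measure" and \<mu> :: "'x set \<Rightarrow> 'a::real_normed_vector"
  assumes \<mu>_empty: "\<mu> {} = 0"
    and \<mu>_sums: "\<And>E. range E \<subseteq> sets M \<Longrightarrow> disjoint_family E \<Longrightarrow> (\<lambda>i::nat. \<mu> (E i)) sums \<mu> (\<Union>i. E i)"
begin

lemma \<mu>_Un:
  assumes "A \<in> sets M" "B \<in> sets M" "A \<inter> B = {}"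
  shows "\<mu> (A \<union> B) = \<mu> A + \<mu> B"
proof -
  have "(\<lambda>i. \<mu> (binaryset A B i)) sums \<mu> (\<Union>i. binaryset A B i)"
    by (rule \<mu>_sums) (use assms in \<open>auto simp: range_binaryset_eq disjoint_family_on_def binaryset_def\<close>)
  moreover have "(\<lambda>i. \<mu> (binaryset A B i)) sums (\<mu> A + \<mu> B)"
    by (rule binaryset_sums) (rule \<mu>_empty)
  ultimately show ?thesis
    by (simp add: UN_binaryset_eq sums_unique2)
qed

lemma \<mu>_split: "A \<in> sets M \<Longrightarrow> B \<in> sets M \<Longrightarrow> \<mu> A = \<mu> (A \<inter> B) + \<mu> (A - B)"
  using \<mu>_Un [of "A \<inter> B" "A - B"] by (simp add: Int_Diff_Un Int_Diff_disjoint sets.Int sets.Diff)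

text \<open>Continuity from above at the empty set: \<open>D \<inter> C 0\<close> is the disjoint
  union of the layers between consecutive \<open>C i\<close>, whose measures telescope.\<close>

lemma \<mu>_Int_decseq:
  assumes D: "D \<in> sets M" and C: "range C \<subseteq> sets M" "decseq C" "(\<Inter>i. C i) = {}"
  shows "(\<lambda>m. \<mu> (D \<inter> C m)) \<longlonglongrightarrow> 0"
proof -
  let ?E = "\<lambda>i. D \<inter> C i - C (Suc i)"
  have sets: "C i \<in> sets M" for i
    using C(1) by auto
  have mono: "x \<in> C j" if "x \<in> C i" "j \<le> i" for x i j
    using decseqD [OF C(2)] that by blast
  have "disjoint_family ?E"
    unfolding disjoint_family_on_def
  proof (intro ballI impI)
    fix i j :: nat assume "i \<noteq> j"
    then show "?E i \<inter> ?E j = {}"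
      using mono by (cases "i < j") (fastforce simp: Suc_le_eq)+
  qed
  moreover have "range ?E \<subseteq> sets M"
    using D sets by auto
  ultimately have "(\<lambda>i. \<mu> (?E i)) sums \<mu> (\<Union>i. ?E i)"
    by (intro \<mu>_sums)
  moreover have "(\<Union>i. ?E i) = D \<inter> C 0"
  proof (intro equalityI subsetI)
    fix x assume x: "x \<in> D \<inter> C 0"
    define k where "k = (LEAST k. x \<notin> C k)"
    have "\<exists>k. x \<notin> C k"
      using C(3) by auto
    then have "x \<notin> C k"
      unfolding k_def by (rule LeastI_ex)
    moreover from this obtain i where "k = Suc i"
      using x by (cases k) auto
    moreover have "x \<in> C i"
      using not_less_Least [of i "\<lambda>k. x \<notin> C k"] \<open>k = Suc i\<close> by (auto simp: k_def)
    ultimately show "x \<in> (\<Union>i. ?E i)"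
      using x by auto
  qed (use mono in auto)
  moreover have "(\<Sum>i<m. \<mu> (?E i)) = \<mu> (D \<inter> C 0) - \<mu> (D \<inter> C m)" for m
  proof (induction m)
    case (Suc m)
    have "\<mu> (D \<inter> C m) = \<mu> (D \<inter> C (Suc m)) + \<mu> (?E m)"
    proof -
      have "D \<inter> C m \<inter> C (Suc m) = D \<inter> C (Suc m)"
        using mono by auto
      then show ?thesis
        using \<mu>_split [of "D \<inter> C m" "C (Suc m)"] D sets by auto
    qed
    then show ?case
      using Suc by simp
  qed simp
  ultimately have "(\<lambda>m. \<mu> (D \<inter> C 0) - \<mu> (D \<inter> C m)) \<longlonglongrightarrow> \<mu> (D \<inter> C 0)"
    by (simp add: sums_def)
  from tendsto_diff [OF tendsto_const [of "\<mu> (D \<inter> C 0)"] this] show ?thesis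
    by simp
qed

text \<open>This takes the place of domination by the total variation measure: otherwise one finds
  disjoint sets whose measures stay away from zero.\<close>

lemma \<mu>_subset_decseq:
  assumes C: "range C \<subseteq> sets M" "decseq C" "(\<Inter>i. C i) = {}"
    and D: "\<And>n. D n \<in> sets M" "\<And>n. D n \<subseteq> C n"
  shows "(\<lambda>n. \<mu> (D n)) \<longlonglongrightarrow> 0"
proof (rule ccontr)
  assume "\<not> (\<lambda>n. \<mu> (D n)) \<longlonglongrightarrow> 0"
  then obtain \<epsilon> where \<epsilon>: "0 < \<epsilon>" "\<And>N. \<exists>n\<ge>N. \<epsilon> \<le> norm (\<mu> (D n))"
    by (auto simp: LIMSEQ_iff not_less)
  have sets: "C i \<in> sets M" for i
    using C(1) by auto
  have mono: "x \<in> C j" if "x \<in> C i" "j \<le> i" for x i j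
    using decseqD [OF C(2)] that by blast
  \<comment> \<open>Some \<open>D n\<close> with \<open>n \<ge> N\<close> has measure at least
    \<open>\<epsilon>\<close>; a late \<open>C m\<close> removes less than
    \<open>\<epsilon> / 2\<close> of it, leaving a set inside \<open>C N - C m\<close>.\<close>
  have step: "\<exists>m B. N < m \<and> B \<in> sets M \<and> B \<subseteq> C N - C m \<and> \<epsilon> / 2 \<le> norm (\<mu> B)" for N
  proof -
    obtain n where n: "N \<le> n" "\<epsilon> \<le> norm (\<mu> (D n))"
      using \<epsilon>(2) by blast
    have "(\<lambda>m. \<mu> (D n \<inter> C m)) \<longlonglongrightarrow> 0"
      using D C by (intro \<mu>_Int_decseq)
    then have "\<forall>\<^sub>F m in sequentially. norm (\<mu> (D n \<inter> C m)) < \<epsilon> / 2"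
      by (rule order_tendstoD(2) [OF tendsto_norm_zero]) (use \<epsilon>(1) in simp)
    then have "\<forall>\<^sub>F m in sequentially. norm (\<mu> (D n \<inter> C m)) < \<epsilon> / 2 \<and> N < m"
      using eventually_gt_at_top by (rule eventually_conj)
    then obtain m where m: "norm (\<mu> (D n \<inter> C m)) < \<epsilon> / 2" "N < m"
      by (auto simp: eventually_sequentially)
    have "\<epsilon> \<le> norm (\<mu> (D n \<inter> C m)) + norm (\<mu> (D n - C m))"
      using n(2) \<mu>_split [OF D(1) [of n] sets [of m]] norm_triangle_ineq order_trans by metis
    then have "\<epsilon> / 2 \<le> norm (\<mu> (D n - C m))"
      using m(1) by simp
    moreover have "D n - C m \<in> sets M" "D n - C m \<subseteq> C N - C m"
      using D mono n(1) sets by blast+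
    ultimately show ?thesis
      using m(2) by blast
  qed
  then obtain next_idx B where nb: "\<And>N. N < next_idx N" "\<And>N. B N \<in> sets M"
      "\<And>N. B N \<subseteq> C N - C (next_idx N)" "\<And>N. \<epsilon> / 2 \<le> norm (\<mu> (B N))"
    by metis
  \<comment> \<open>Iterating \<open>next_idx\<close> makes the sets
    \<open>C (idx k) - C (idx (Suc k))\<close> disjoint, and each contains a set of measure at least
    \<open>\<epsilon> / 2\<close>.\<close>
  define idx where "idx k = (next_idx ^^ k) 0" for k
  have idx_Suc: "idx (Suc k) = next_idx (idx k)" for k
    by (simp add: idx_def)
  have "strict_mono idx"
    using nb(1) by (intro strict_monoI_Suc) (simp add: idx_Suc)
  then have idx_mono: "idx (Suc i) \<le> idx j" if "i < j" for i j
    using that strict_mono_less_eq [of idx "Suc i" j] by simp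
  have disj_lt: "B (idx i) \<inter> B (idx j) = {}" if "i < j" for i j
  proof -
    have "B (idx j) \<subseteq> C (idx (Suc i))"
      using nb(3) [of "idx j"] mono idx_mono [OF that] by blast
    then show ?thesis
      using nb(3) [of "idx i"] by (auto simp: idx_Suc)
  qed
  have "disjoint_family (\<lambda>k. B (idx k))"
    unfolding disjoint_family_on_def using disj_lt by (metis Int_commute linorder_neqE_nat)
  moreover have "range (\<lambda>k. B (idx k)) \<subseteq> sets M"
    using nb(2) by auto
  ultimately have "summable (\<lambda>k. \<mu> (B (idx k)))"
    using \<mu>_sums sums_summable by blast
  then have "(\<lambda>k. norm (\<mu> (B (idx k)))) \<longlonglongrightarrow> 0"
    using summable_LIMSEQ_zero tendsto_norm_zero by blast
  then have "\<epsilon> / 2 \<le> 0"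
    by (rule LIMSEQ_le_const) (use nb(4) in auto)
  then show False
    using \<epsilon>(1) by simp
qed

text \<open>Vanishing is demanded hereditarily, because cancellation lets a vector measure vanish on
  a set but not on its subsets.\<close>

definition null :: "'x set \<Rightarrow> bool" where
  "null Z \<longleftrightarrow> Z \<in> sets M \<and> (\<forall>E\<in>sets M. E \<subseteq> Z \<longrightarrow> \<mu> E = 0)"

lemma null_empty: "null {}"
  by (simp add: null_def \<mu>_empty)

lemma null_sets: "null Z \<Longrightarrow> Z \<in> sets M"
  and null_subset: "null Z \<Longrightarrow> A \<in> sets M \<Longrightarrow> A \<subseteq> Z \<Longrightarrow> \<mu> A = 0"
  by (simp_all add: null_def)

lemma null_Un:
  assumes "null Z" "null W"
  shows "null (Z \<union> W)"
  unfolding null_def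
proof (intro conjI ballI impI)
  show "Z \<union> W \<in> sets M"
    using assms null_sets by blast
  fix E assume E: "E \<in> sets M" "E \<subseteq> Z \<union> W"
  have "\<mu> (E \<inter> Z) = 0"
    by (rule null_subset [OF assms(1)]) (use E null_sets [OF assms(1)] in auto)
  moreover have "\<mu> (E - Z) = 0"
    by (rule null_subset [OF assms(2)]) (use E null_sets [OF assms(1)] in auto)
  ultimately show "\<mu> E = 0"
    using \<mu>_split [OF E(1) null_sets [OF assms(1)]] by simp
qed

lemma null_UN: "finite I \<Longrightarrow> (\<And>i. i \<in> I \<Longrightarrow> null (Z i)) \<Longrightarrow> null (\<Union>i\<in>I. Z i)"
  by (induction I rule: finite_induct) (simp_all add: null_empty null_Un)

text \<open>A dominated convergence statement for sets: off \<open>Z\<close>, the points where some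
  \<open>E n\<close> with \<open>n \<ge> N\<close> still disagrees with \<open>F\<close> form sets
  \<open>C N\<close> decreasing to the empty set.\<close>

lemma \<mu>_tendsto:
  assumes E: "\<And>n. E n \<in> sets M" "F \<in> sets M" and Z: "null Z"
    and lim: "\<And>u. u \<notin> Z \<Longrightarrow> \<forall>\<^sub>F n in sequentially. u \<in> E n \<longleftrightarrow> u \<in> F"
  shows "(\<lambda>n. \<mu> (E n)) \<longlonglongrightarrow> \<mu> F"
proof -
  have Z': "Z \<in> sets M" "\<And>A. A \<in> sets M \<Longrightarrow> A \<subseteq> Z \<Longrightarrow> \<mu> A = 0"
    using null_sets [OF Z] null_subset [OF Z] by auto
  define C where "C N = (\<Union>n\<in>{N..}. (E n - F) \<union> (F - E n)) - Z" for N
  have sets: "range C \<subseteq> sets M"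
    using E Z' by (auto simp: C_def)
  have dec: "decseq C"
    by (rule decseq_SucI) (force simp: C_def)
  have "(\<Inter>N. C N) = {}"
  proof (intro equals0I)
    fix u assume u: "u \<in> (\<Inter>N. C N)"
    then have "u \<notin> Z" by (auto simp: C_def)
    then obtain N where "\<And>n. n \<ge> N \<Longrightarrow> u \<in> E n \<longleftrightarrow> u \<in> F"
      using lim by (auto simp: eventually_sequentially)
    then have "u \<notin> C N"
      by (auto simp: C_def)
    then show False
      using u by blast
  qed
  note C = sets dec this
  have "(\<lambda>n. \<mu> (E n - F - Z)) \<longlonglongrightarrow> 0" "(\<lambda>n. \<mu> (F - E n - Z)) \<longlonglongrightarrow> 0"
    by (rule \<mu>_subset_decseq [OF C]; use E Z' in \<open>force simp: C_def\<close>)+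
  then have "(\<lambda>n. \<mu> F + (\<mu> (E n - F - Z) - \<mu> (F - E n - Z))) \<longlonglongrightarrow> \<mu> F + (0 - 0)"
    by (intro tendsto_intros)
  moreover have "\<mu> (E n) = \<mu> F + (\<mu> (E n - F - Z) - \<mu> (F - E n - Z))" for n
  proof -
    have minus_Z: "\<mu> A = \<mu> (A - Z)" if "A \<in> sets M" for A
      using \<mu>_split [OF that Z'(1)] Z'(2) [of "A \<inter> Z"] that Z'(1) by auto
    have "\<mu> (E n) = \<mu> (E n \<inter> F) + \<mu> (E n - F - Z)"
      using \<mu>_split [OF E(1) E(2), of n] minus_Z [of "E n - F"] E by auto
    moreover have "\<mu> F = \<mu> (E n \<inter> F) + \<mu> (F - E n - Z)"
      using \<mu>_split [OF E(2) E(1), of n] minus_Z [of "F - E n"] E by (auto simp: Int_commute)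
    ultimately show ?thesis by simp
  qed
  ultimately show ?thesis
    by simp
qed

end

section \<open>Voronoi regions\<close>

lemma norm_vector_scalar_mult:
  fixes c :: "'a::real_normed_div_algebra" and x :: "'a ^ 'n"
  shows "norm (c *s x) = norm c * norm x"
  by (simp add: norm_vec_def norm_mult L2_set_right_distrib)

lemma continuous_on_vector_scalar_mult [continuous_intros]:
  fixes f :: "_ \<Rightarrow> 'a::real_normed_algebra" and g :: "_ \<Rightarrow> 'a ^ 'n"
  shows "continuous_on S f \<Longrightarrow> continuous_on S g \<Longrightarrow> continuous_on S (\<lambda>x. f x *s g x)"
  unfolding vector_scalar_mult_def by (intro continuous_intros)

lemma scalar_cnj_of_real [simp]: "scalar_cnj (of_real t :: 'a::conj_div_algebra) = of_real t"
  using mult_scalar_cnj [of "1 :: 'a"] scalar_cnj_scaleR [of t "1 :: 'a"]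
  by (simp add: of_real_def)

text \<open>The parameter \<open>b\<close> is restricted to a real ray, so the sites are
  \<open>(g - t) a\<close>; varying \<open>t\<close> gives the homotopy.\<close>

abbreviation ray_region where
  "ray_region G t a g \<equiv> voronoi_region G a (- of_real t) g"

lemma mem_ray_region:
  fixes a :: "'a::conj_div_algebra ^ 'n"
  shows "u \<in> ray_region G t a g \<longleftrightarrow>
    (\<forall>g'\<in>G. norm (u - (g - of_real t) *s a) \<le> norm (u - (g' - of_real t) *s a))"
proof -
  have "scalar_cnj (- of_real t :: 'a) = - of_real t"
    using scalar_cnj_of_real [of "- t", where 'a = 'a] by simp
  moreover have "u - (- of_real t) *s a - g *s a = u - (g - of_real t) *s a" for g
    by (simp add: vec_eq_iff algebra_simps)
  ultimately show ?thesis
    by (simp only: voronoi_region_def mem_Collect_eq)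
qed

lemma closed_ray_region: "closed (ray_region G t a g)"
proof -
  have "ray_region G t a g
      = (\<Inter>g'\<in>G. {u. norm (u - (g - of_real t) *s a) \<le> norm (u - (g' - of_real t) *s a)})"
    by (auto simp: mem_ray_region)
  then show ?thesis
    by (auto intro!: closed_INT closed_Collect_le continuous_intros)
qed

text \<open>Off the finitely many bisecting hyperplanes of the limit position all distance
  comparisons with the site of \<open>g\<close> are strict, hence persist nearby.\<close>

lemma tendsto_ray_region:
  fixes a :: "'a::conj_div_algebra ^ 'n::finite"
  assumes \<mu>: "mass_distribution \<mu>" and G: "finite G" "g \<in> G"
    and a: "norm a = 1" and lim: "x \<longlonglongrightarrow> a" "t \<longlonglongrightarrow> s"
  shows "(\<lambda>n. \<mu> (ray_region G (t n) (x n) g)) \<longlonglongrightarrow> \<mu> (ray_region G s a g)"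
proof -
  interpret vector_measure borel \<mu>
    by unfold_locales (use \<mu> in \<open>auto simp: mass_distribution_def\<close>)
  define N where "N h s a u = norm (u - (h - of_real s) *s a)" for h :: 'a and s and a u :: "'a ^ 'n"
  define Z where "Z = (\<Union>g'\<in>G - {g}. {u. N g s a u = N g' s a u})"
  have null: "null {u. N g s a u = N g' s a u}" if "g' \<noteq> g" for g'
  proof -
    define v w where "v = (g - of_real s) *s a" and "w = (g' - of_real s) *s a"
    have "v - w = (g - g') *s a"
      by (simp add: v_def w_def vec_eq_iff algebra_simps)
    then have "v - w \<noteq> 0"
      using that a norm_vector_scalar_mult [of "g - g'" a] by auto
    \<comment> \<open>The bisector of the distinct sites \<open>v\<close> and \<open>w\<close> is a
      hyperplane with normal vector \<open>v - w\<close>.\<close>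
    have "N g s a u = N g' s a u \<longleftrightarrow> (v - w) \<bullet> u = (v \<bullet> v - w \<bullet> w) / 2" for u
    proof -
      have "N g s a u = N g' s a u \<longleftrightarrow> (u - v) \<bullet> (u - v) = (u - w) \<bullet> (u - w)"
        by (simp add: N_def v_def w_def norm_eq)
      then show ?thesis
        by (auto simp: inner_diff inner_commute)
    qed
    then have "{u. N g s a u = N g' s a u} = {u. (v - w) \<bullet> u = (v \<bullet> v - w \<bullet> w) / 2}"
      by simp
    moreover have "closed {u. (v - w) \<bullet> u = (v \<bullet> v - w \<bullet> w) / 2}"
      by (rule closed_hyperplane)
    ultimately show ?thesis
      using \<mu> \<open>v - w \<noteq> 0\<close> unfolding null_def mass_distribution_def by (metis borel_closed)
  qed
  have "null Z"
    unfolding Z_def using G null by (intro null_UN) auto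
  have N_lim: "(\<lambda>n. N h (t n) (x n) u) \<longlonglongrightarrow> N h s a u" for h u
  proof -
    have "continuous_on UNIV (\<lambda>(s, a). N h s a u)"
      unfolding N_def case_prod_unfold by (intro continuous_intros)
    then have "isCont (\<lambda>(s, a). N h s a u) (s, a)"
      by (simp add: continuous_on_eq_continuous_at)
    from isCont_tendsto_compose [OF this tendsto_Pair [OF lim(2,1)]] show ?thesis
      by simp
  qed
  have less: "\<forall>\<^sub>F n in sequentially. N h (t n) (x n) u < N h' (t n) (x n) u"
    if "N h s a u < N h' s a u" for h h' u
    using order_tendstoD(1) [OF tendsto_diff [OF N_lim N_lim], of 0 h' u h u] that by simp
  show ?thesis
  proof (rule \<mu>_tendsto [OF _ _ \<open>null Z\<close>])
    fix u assume "u \<notin> Z"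
    then have ne: "N g s a u \<noteq> N g' s a u" if "g' \<in> G" "g' \<noteq> g" for g'
      using that by (auto simp: Z_def)
    show "\<forall>\<^sub>F n in sequentially. u \<in> ray_region G (t n) (x n) g \<longleftrightarrow> u \<in> ray_region G s a g"
    proof (cases "u \<in> ray_region G s a g")
      case True
      have "\<forall>\<^sub>F n in sequentially. \<forall>g'\<in>G. N g (t n) (x n) u \<le> N g' (t n) (x n) u"
      proof (intro eventually_ball_finite G(1) ballI)
        fix g' assume "g' \<in> G"
        show "\<forall>\<^sub>F n in sequentially. N g (t n) (x n) u \<le> N g' (t n) (x n) u"
        proof (cases "g' = g")
          case False
          have "N g s a u \<le> N g' s a u"
            using True \<open>g' \<in> G\<close> by (simp only: mem_ray_region N_def)
          then have "N g s a u < N g' s a u"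
            using ne [OF \<open>g' \<in> G\<close> False] by simp
          from less [OF this] show ?thesis
            by (rule eventually_mono) (rule less_imp_le)
        qed simp
      qed
      then show ?thesis
        using True by (simp add: mem_ray_region N_def)
    next
      case False
      then obtain g' where g': "g' \<in> G" "N g' s a u < N g s a u"
        unfolding mem_ray_region N_def by (meson not_le)
      from less [OF g'(2)] have "\<forall>\<^sub>F n in sequentially. u \<notin> ray_region G (t n) (x n) g"
        by (rule eventually_mono) (use g'(1) in \<open>auto simp: mem_ray_region N_def not_le\<close>)
      then show ?thesis
        using False by simp
    qed
  qed (auto simp: closed_ray_region)
qed

text \<open>As the sites move off to infinity, each fixed point is eventually closest to the site of
  \<open>1\<close>. The directions \<open>x n\<close> vary with \<open>n\<close>, which yields
  uniformity over the sphere.\<close>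

lemma tendsto_ray_region_at_top:
  fixes x :: "nat \<Rightarrow> 'a::conj_div_algebra ^ 'n::finite"
  assumes \<mu>: "mass_distribution \<mu>" and G: "finite G" "G \<subseteq> sphere 0 1" "1 \<in> G" "g \<in> G"
    and x: "\<And>n. norm (x n) = 1"
  shows "(\<lambda>n. \<mu> (ray_region G (real n) (x n) g)) \<longlonglongrightarrow> (if g = 1 then \<mu> UNIV else 0)"
proof -
  interpret vector_measure borel \<mu>
    by unfold_locales (use \<mu> in \<open>auto simp: mass_distribution_def\<close>)
  define N where "N h n u = norm (u - (h - of_real (real n)) *s x n)" for h n u
  have less: "\<forall>\<^sub>F n in sequentially. N 1 n u < N h n u" if h: "h \<in> G" "h \<noteq> 1" for h u
  proof -
    have norm_h: "norm h = 1"
      using G(2) h(1) by auto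
    have hh: "h \<bullet> h = 1" "(1::'a) \<bullet> 1 = 1"
      using norm_h power2_norm_eq_inner [of h] power2_norm_eq_inner [of "1 :: 'a"] by auto
    \<comment> \<open>For unit \<open>h\<close>, \<open>1 - h \<bullet> 1\<close> is half of this
      square.\<close>
    have "0 < (h - 1) \<bullet> (h - 1)"
      using h(2) by simp
    then have \<delta>: "0 < 1 - h \<bullet> 1"
      using hh by (simp add: inner_diff inner_commute)
    \<comment> \<open>Half the difference of the squared distances is
      \<open>n (1 - h \<bullet> 1)\<close> minus an inner product with \<open>u\<close> of size at
      most \<open>2 * norm u\<close>.\<close>
    have "N 1 n u < N h n u" if n: "2 * norm u / (1 - h \<bullet> 1) < real n" for n
    proof -
      have sq: "(N k n u)\<^sup>2 = u \<bullet> u - 2 * (u \<bullet> ((k - of_real (real n)) *s x n)) + (norm (k - of_real (real n)))\<^sup>2" for k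
      proof -
        have "((k - of_real (real n)) *s x n) \<bullet> ((k - of_real (real n)) *s x n) = (norm (k - of_real (real n)))\<^sup>2"
          by (simp only: norm_vector_scalar_mult x mult_1_right flip: power2_norm_eq_inner)
        then show ?thesis
          by (simp add: N_def power2_norm_eq_inner inner_diff inner_commute)
      qed
      have norm_sq: "(norm (k - of_real (real n)))\<^sup>2 = 1 - 2 * real n * (k \<bullet> 1) + (real n)\<^sup>2" if "k \<bullet> k = 1" for k :: 'a
        using that hh unfolding power2_norm_eq_inner of_real_def
        by (simp add: inner_diff inner_commute power2_eq_square)
      have "u \<bullet> ((h - of_real (real n)) *s x n) - u \<bullet> ((1 - of_real (real n)) *s x n) = u \<bullet> ((h - 1) *s x n)"
        by (simp flip: inner_diff_right)
      also have "\<dots> \<le> norm u * norm (h - 1)"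
        using norm_cauchy_schwarz [of u "(h - 1) *s x n"]
        by (simp only: norm_vector_scalar_mult x mult_1_right)
      also have "\<dots> \<le> norm u * 2"
        using norm_triangle_ineq4 [of h 1] norm_h by (intro mult_left_mono) auto
      finally have "u \<bullet> ((h - of_real (real n)) *s x n) - u \<bullet> ((1 - of_real (real n)) *s x n) \<le> 2 * norm u"
        by simp
      moreover have "2 * norm u < real n * (1 - h \<bullet> 1)"
        using n \<delta> by (simp add: pos_divide_less_eq)
      ultimately have "(N 1 n u)\<^sup>2 < (N h n u)\<^sup>2"
        unfolding sq norm_sq [OF hh(1)] norm_sq [OF hh(2)] hh by (simp add: algebra_simps)
      then show ?thesis
        by (rule power2_less_imp_less) (simp add: N_def)
    qed
    moreover have "\<forall>\<^sub>F n in sequentially. 2 * norm u / (1 - h \<bullet> 1) < real n"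
      using filterlim_real_sequentially unfolding filterlim_at_top_dense by blast
    ultimately show ?thesis
      by (rule eventually_mono [rotated])
  qed
  have "(\<lambda>n. \<mu> (ray_region G (real n) (x n) g)) \<longlonglongrightarrow> \<mu> (if g = 1 then UNIV else {})"
  proof (rule \<mu>_tendsto [OF _ _ null_empty])
    fix u
    show "\<forall>\<^sub>F n in sequentially. u \<in> ray_region G (real n) (x n) g \<longleftrightarrow> u \<in> (if g = 1 then UNIV else {})"
    proof (cases "g = 1")
      case True
      have "\<forall>\<^sub>F n in sequentially. \<forall>h\<in>G. N 1 n u \<le> N h n u"
      proof (intro eventually_ball_finite G(1) ballI)
        fix h assume "h \<in> G"
        then show "\<forall>\<^sub>F n in sequentially. N 1 n u \<le> N h n u"
          using less [of h u] by (cases "h = 1") (auto elim: eventually_mono)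
      qed
      then show ?thesis
        unfolding True by (simp only: mem_ray_region N_def if_True UNIV_I simp_thms)
    next
      case False
      have "\<forall>\<^sub>F n in sequentially. u \<notin> ray_region G (real n) (x n) g"
        using less [OF G(4) False, of u]
        unfolding mem_ray_region N_def by (rule eventually_mono) (use G(3) in \<open>meson not_le\<close>)
      then show ?thesis
        using False by simp
    qed
  qed (rule borel_closed [OF closed_ray_region], simp)
  then show ?thesis
    by (cases "g = 1") (simp_all add: \<mu>_empty)
qed

text \<open>For \<open>t = 0\<close> the sites of \<open>h *s a\<close> are those of
  \<open>a\<close>, relabelled by \<open>g \<mapsto> g * h\<close>.\<close>

lemma ray_region_rotate:
  assumes "\<And>g. g \<in> G \<Longrightarrow> g * h \<in> G" "\<And>g. g \<in> G \<Longrightarrow> \<exists>g'\<in>G. g = g' * h"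
  shows "ray_region G 0 (h *s a) g = ray_region G 0 a (g * h)"
proof -
  have "(\<forall>g'\<in>G. P (g' * h)) \<longleftrightarrow> (\<forall>g'\<in>G. P g')" for P
    using assms by metis
  from this [of "\<lambda>k. norm (u - (g * h) *s a) \<le> norm (u - k *s a)" for u] show ?thesis
    unfolding set_eq_iff mem_ray_region by (simp only: vector_smult_assoc of_real_0 diff_zero simp_thms)
qed

section \<open>The group \<open>G\<close> and its automorphisms\<close>

lemma sphere_group_simps:
  assumes "subgroup G (sphere_group :: 'a::conj_div_algebra monoid)"
  shows "G \<subseteq> sphere 0 1" "1 \<in> G" "\<And>g h. g \<in> G \<Longrightarrow> h \<in> G \<Longrightarrow> g * h \<in> G"
    "\<And>g. g \<in> G \<Longrightarrow> inverse g \<in> G" "\<And>g. g \<in> G \<Longrightarrow> g \<noteq> 0"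
proof -
  interpret subgroup G "sphere_group :: 'a monoid" by (rule assms)
  show sub: "G \<subseteq> sphere 0 1" and "1 \<in> G" and "\<And>g h. g \<in> G \<Longrightarrow> h \<in> G \<Longrightarrow> g * h \<in> G"
    using subset one_closed m_closed by (simp_all add: sphere_group_def)
  show nz: "g \<noteq> 0" if "g \<in> G" for g
    using sub that by auto
  show "inverse g \<in> G" if "g \<in> G" for g
  proof -
    have "inv\<^bsub>sphere_group\<^esub> g = inverse g"
      by (rule group.inv_equality [OF group_sphere_group])
        (use that sub nz [OF that] in \<open>auto simp: sphere_group_def norm_inverse left_inverse\<close>)
    then show ?thesis
      using m_inv_closed [OF that] by simp
  qed
qed

lemma finite_subgroup_primitive_root:
  assumes G: "subgroup G (sphere_group :: 'a::conj_div_algebra monoid)" "finite G" "G \<noteq> {1}"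
  obtains h p where "h \<in> G" "primitive_root h p"
proof -
  note G' = sphere_group_simps [OF G(1)]
  obtain h where h: "h \<in> G" "h \<noteq> 1"
    using G(3) G'(2) by blast
  have pow: "h ^ k \<in> G" for k
    by (induction k) (use G' h in auto)
  then have "\<not> inj (\<lambda>k. h ^ k)"
    using G(2) by (metis finite_imageD finite_subset image_subsetI infinite_UNIV_nat)
  then obtain i j where ij: "i < j" "h ^ i = h ^ j"
    unfolding inj_on_def by (metis linorder_neqE_nat)
  have "h ^ i * h ^ (j - i) = h ^ j"
    using ij(1) by (simp flip: power_add)
  then have "h ^ i * h ^ (j - i) = h ^ i * 1"
    using ij(2) by simp
  then have "h ^ (j - i) = 1"
    using G'(5) [OF pow] mult_left_cancel by metis
  then have ex: "\<exists>k. 0 < k \<and> h ^ k = 1"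
    using ij(1) by (metis zero_less_diff)
  define p where "p = (LEAST k. 0 < k \<and> h ^ k = 1)"
  have p: "0 < p" "h ^ p = 1" "\<And>k. 0 < k \<Longrightarrow> k < p \<Longrightarrow> h ^ k \<noteq> 1"
    using LeastI_ex [OF ex] not_less_Least unfolding p_def by blast+
  moreover have "p \<noteq> 1"
    using p(2) h(2) by auto
  ultimately have "primitive_root h p"
    by (auto simp: primitive_root_def)
  then show thesis
    using that h(1) by blast
qed

lemma sphere_group_iso:
  assumes G: "subgroup G (sphere_group :: 'a::conj_div_algebra monoid)"
    and \<phi>: "\<phi> \<in> iso (sphere_group\<lparr>carrier := G\<rparr>) (sphere_group\<lparr>carrier := G\<rparr>)"
  shows "\<And>g. g \<in> G \<Longrightarrow> \<phi> g \<in> G" "\<And>g h. g \<in> G \<Longrightarrow> h \<in> G \<Longrightarrow> \<phi> (g * h) = \<phi> g * \<phi> h"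
    "\<phi> 1 = 1" "\<And>h p. h \<in> G \<Longrightarrow> primitive_root h p \<Longrightarrow> primitive_root (\<phi> h) p"
proof -
  note G' = sphere_group_simps [OF G]
  have hom: "\<phi> \<in> hom (sphere_group\<lparr>carrier := G\<rparr>) (sphere_group\<lparr>carrier := G\<rparr>)"
    and bij: "bij_betw \<phi> G G"
    using \<phi> by (auto simp: iso_def)
  show closed: "\<phi> g \<in> G" if "g \<in> G" for g
    using bij that by (auto simp: bij_betw_def)
  show mult: "\<phi> (g * h) = \<phi> g * \<phi> h" if "g \<in> G" "h \<in> G" for g h
    using hom that by (auto simp: hom_def sphere_group_def)
  have "\<phi> 1 * \<phi> 1 = \<phi> 1 * 1"
    using mult [OF G'(2) G'(2)] by simp
  then show one: "\<phi> 1 = 1"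
    using G'(5) [OF closed [OF G'(2)]] mult_left_cancel by metis
  show "primitive_root (\<phi> h) p" if h: "h \<in> G" "primitive_root h p" for h p
  proof -
    have pow: "h ^ k \<in> G \<and> \<phi> (h ^ k) = \<phi> h ^ k" for k
      by (induction k) (use h G' one mult in auto)
    have "\<phi> h ^ k = 1 \<longleftrightarrow> h ^ k = 1" for k
    proof -
      have "\<phi> h ^ k = 1 \<longleftrightarrow> \<phi> (h ^ k) = \<phi> 1"
        using pow one by simp
      also have "\<dots> \<longleftrightarrow> h ^ k = 1"
        using bij pow [of k] G'(2) by (auto simp: bij_betw_def inj_on_def)
      finally show ?thesis .
    qed
    then show ?thesis
      using h(2) by (simp add: primitive_root_def)
  qed
qed

text \<open>The assumption \<open>cover\<close> collects what has to be proved separately for each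
  of the three scalar types.\<close>

theorem voronoi_equipartition:
  fixes \<mu> :: "'n::finite \<Rightarrow> ('a::conj_div_algebra ^ 'n) set \<Rightarrow> 'a"
  assumes cover: "\<And>(q::'a) p. primitive_root q p \<Longrightarrow> norm q = 1 \<Longrightarrow>
        \<exists>E. rotation_cover (top_of_set (- {0})) ((*) q) p DIM('a) E"
    and G: "subgroup G sphere_group" "finite G" "G \<noteq> {1}"
    and \<mu>: "\<And>i. mass_distribution (\<mu> i)"
    and \<phi>: "\<And>i. \<phi> i \<in> iso (sphere_group\<lparr>carrier := G\<rparr>) (sphere_group\<lparr>carrier := G\<rparr>)"
  shows "\<exists>a \<in> sphere 0 1. \<exists>b. \<forall>i.
          (\<Sum>g\<in>G. inverse (\<phi> i g) * \<mu> i (voronoi_region G a b g)) = 0"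
proof (rule ccontr)
  assume contra: "\<not> ?thesis"
  note G' = sphere_group_simps [OF G(1)] and \<phi>' = sphere_group_iso [OF G(1) \<phi>]
  define f :: "real \<times> ('a ^ 'n) \<Rightarrow> 'a ^ 'n"
    where "f = (\<lambda>(t, a). \<chi> i. \<Sum>g\<in>G. inverse (\<phi> i g) * \<mu> i (ray_region G t a g))"
  have f_nz: "f (t, a) \<noteq> 0" if "norm a = 1" for t a
    using contra that by (auto simp: f_def vec_eq_iff)
  have f_cont: "continuous_on (UNIV \<times> sphere 0 1) f"
    unfolding continuous_on_sequentially o_def
  proof (intro allI ballI impI, elim conjE)
    fix y :: "nat \<Rightarrow> real \<times> ('a ^ 'n)" and z
    assume z: "z \<in> UNIV \<times> sphere 0 1" and y: "y \<longlonglongrightarrow> z"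
    have "(\<lambda>n. f (fst (y n), snd (y n))) \<longlonglongrightarrow> f (fst z, snd z)"
      unfolding f_def case_prod_conv
      by (intro tendsto_vec_lambda tendsto_sum tendsto_mult_left tendsto_ray_region
          \<mu> G tendsto_fst tendsto_snd y) (use z in auto)
    then show "(\<lambda>n. f (y n)) \<longlonglongrightarrow> f z"
      by simp
  qed
  define c :: "'a ^ 'n" where "c = (\<chi> i. \<mu> i UNIV)"
  have "c \<noteq> 0"
    using \<mu> by (auto simp: c_def vec_eq_iff mass_distribution_def)
  \<comment> \<open>Otherwise every \<open>n\<close> has a bad direction \<open>x n\<close>, against
    the convergence along arbitrary sequences of directions.\<close>
  obtain m where m: "\<And>a. norm a = 1 \<Longrightarrow> norm (f (real m, a) - c) < norm c"
  proof (rule ccontr)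
    assume "\<not> thesis"
    then have "\<forall>n. \<exists>a. norm a = 1 \<and> norm c \<le> norm (f (real n, a) - c)"
      using that by (meson not_le)
    then obtain x where x: "\<And>n. norm (x n) = 1" "\<And>n. norm c \<le> norm (f (real n, x n) - c)"
      by metis
    have "(\<lambda>n. f (real n, x n)) \<longlonglongrightarrow> (\<chi> i. \<Sum>g\<in>G. inverse (\<phi> i g) * (if g = 1 then \<mu> i UNIV else 0))"
      unfolding f_def case_prod_conv
      by (intro tendsto_vec_lambda tendsto_sum tendsto_mult_left tendsto_ray_region_at_top \<mu> G G' x)
    moreover have "(\<Sum>g\<in>G. inverse (\<phi> i g) * (if g = 1 then \<mu> i UNIV else 0)) = \<mu> i UNIV" for i
      using G(2) G'(2) by (simp add: if_distrib [of "\<lambda>x. _ * x"] \<phi>'(3) cong: if_cong)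
    ultimately have "(\<lambda>n. f (real n, x n)) \<longlonglongrightarrow> c"
      by (simp add: c_def)
    then have "(\<lambda>n. norm (f (real n, x n) - c)) \<longlonglongrightarrow> 0"
      by (intro tendsto_norm_zero) (simp add: LIM_zero_iff)
    then have "norm c \<le> 0"
      by (rule LIMSEQ_le_const) (use x(2) in auto)
    then show False
      using \<open>c \<noteq> 0\<close> by simp
  qed
  let ?X = "top_of_set (sphere (0 :: 'a ^ 'n) 1)" and ?Y = "top_of_set (- {0 :: 'a ^ 'n})"
  have f_cont_t: "continuous_on (sphere 0 1) (\<lambda>a. f (t, a))" for t
    by (rule continuous_on_compose2 [OF f_cont]) (auto intro!: continuous_intros)
  have "homotopic_with (\<lambda>_. True) ?X ?Y (\<lambda>a. f (0, a)) (\<lambda>a. f (real m, a))"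
    unfolding homotopic_with_def
  proof (intro exI conjI ballI allI)
    have "continuous_on ({0..1} \<times> sphere 0 1) (\<lambda>z. f (fst z * real m, snd z))"
      by (rule continuous_on_compose2 [OF f_cont]) (auto intro!: continuous_intros)
    then show "continuous_map (prod_topology (top_of_set {0..1}) ?X) ?Y (\<lambda>z. f (fst z * real m, snd z))"
      using f_nz by (auto simp: continuous_map_in_subtopology)
  qed simp_all
  moreover have "homotopic_with (\<lambda>_. True) ?X ?Y (\<lambda>a. f (real m, a)) (\<lambda>_. c)"
  proof (rule homotopic_with_linear [OF f_cont_t continuous_on_const])
    fix a :: "'a ^ 'n" assume a: "a \<in> sphere 0 1"
    \<comment> \<open>Both endpoints lie in the open ball about \<open>c\<close> of radius
      \<open>norm c\<close>, which is convex and omits 0.\<close>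
    have "closed_segment (f (real m, a)) c \<subseteq> ball c (norm c)"
      using m [of a] a \<open>c \<noteq> 0\<close>
      by (intro closed_segment_subset convex_ball) (auto simp: dist_norm norm_minus_commute)
    then show "closed_segment (f (real m, a)) c \<subseteq> - {0}"
      by (auto simp: dist_norm)
  qed
  ultimately have null: "homotopic_with (\<lambda>_. True) ?X ?Y (\<lambda>a. f (0, a)) (\<lambda>_. c)"
    by (rule homotopic_with_trans)
  obtain h p where h: "h \<in> G" "primitive_root h p"
    using finite_subgroup_primitive_root [OF G] .
  have norm_h: "norm h = 1" "h \<noteq> 0"
    using G' h by auto
  have norm_\<phi>: "norm (\<phi> i h) = 1" for i
    using subsetD [OF G'(1) \<phi>'(1) [OF h(1)]] by simp
  have "\<exists>F. rotation_cover ?Y (\<lambda>y. \<chi> i. \<phi> i h * y $ i) p (CARD('n) * DIM('a)) F"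
    by (intro rotation_cover_vec cover norm_\<phi> \<phi>'(4) h)
  then obtain F where F: "rotation_cover ?Y (\<lambda>y. \<chi> i. \<phi> i h * y $ i) p (CARD('n) * DIM('a)) F" ..
  \<comment> \<open>Reindexing by \<open>g \<mapsto> g * h\<close> matches the regions; as
    \<open>\<phi> i (g * h)\<close> has inverse
    \<open>inverse (\<phi> i h) * inverse (\<phi> i g)\<close>, the factor from \<open>h\<close>
    leaves the sum on the left.\<close>
  have equiv: "f (0, h *s a) = (\<chi> i. \<phi> i h * f (0, a) $ i)" for a
  proof -
    have bij: "bij_betw (\<lambda>g. g * h) G G"
      by (rule bij_betw_byWitness [where f' = "\<lambda>g. g * inverse h"])
        (use G' h(1) norm_h in \<open>auto simp: mult.assoc\<close>)
    have rot: "ray_region G 0 (h *s a) g = ray_region G 0 a (g * h)" for g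
      by (rule ray_region_rotate) (use bij in \<open>auto simp: bij_betw_def\<close>)
    have "(\<Sum>g\<in>G. inverse (\<phi> i g) * \<mu> i (ray_region G 0 (h *s a) g))
        = \<phi> i h * (\<Sum>g\<in>G. inverse (\<phi> i g) * \<mu> i (ray_region G 0 a g))" for i
    proof -
      have "(\<Sum>g\<in>G. inverse (\<phi> i g) * \<mu> i (ray_region G 0 a g))
          = (\<Sum>g\<in>G. inverse (\<phi> i (g * h)) * \<mu> i (ray_region G 0 a (g * h)))"
        by (rule sum.reindex_bij_betw [OF bij, symmetric])
      also have "\<phi> i h * \<dots> = (\<Sum>g\<in>G. inverse (\<phi> i g) * \<mu> i (ray_region G 0 (h *s a) g))"
        unfolding sum_distrib_left rot
      proof (rule sum.cong [OF refl])
        fix g assume g: "g \<in> G"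
        have nz: "\<phi> i g \<noteq> 0" "\<phi> i h \<noteq> 0"
          using G'(5) \<phi>'(1) g h(1) by auto
        have "\<phi> i h * inverse (\<phi> i (g * h)) = inverse (\<phi> i g)"
          using nz by (simp add: \<phi>'(2) [OF g h(1)] nonzero_inverse_mult_distrib flip: mult.assoc)
        then show "\<phi> i h * (inverse (\<phi> i (g * h)) * \<mu> i (ray_region G 0 a (g * h)))
            = inverse (\<phi> i g) * \<mu> i (ray_region G 0 a (g * h))"
          by (simp flip: mult.assoc)
      qed
      finally show ?thesis ..
    qed
    then show ?thesis
      by (simp add: f_def)
  qed
  have h_pow: "((\<lambda>a. h *s a) ^^ k) a = h ^ k *s a" for k and a :: "'a ^ 'n"
    by (induction k) (simp_all add: vector_smult_assoc)
  have "\<not> homotopic_with (\<lambda>_. True) ?X ?Y (\<lambda>a. f (0, a)) (\<lambda>_. c)"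
  proof (rule equivariant_map_not_nullhomotopic [of p "CARD('n) * DIM('a)" ?X "\<lambda>a. h *s a" ?Y _
        "\<lambda>y. \<chi> i. \<phi> i h * y $ i" F c])
    show "2 \<le> p"
      using h(2) by (simp add: primitive_root_def)
    show "continuous_map ?X ?X (\<lambda>a. h *s a)"
      using norm_h
      by (auto simp: continuous_map_in_subtopology norm_vector_scalar_mult intro!: continuous_intros)
    show "((\<lambda>a. h *s a) ^^ p) x = x" for x :: "'a ^ 'n"
      using h(2) by (simp add: h_pow primitive_root_def)
    show "trivial_group (reduced_homology_group (int n) ?X)" if "Suc n < CARD('n) * DIM('a)" for n
      by (rule trivial_reduced_homology_group_sphere) (use that in simp)
    show "continuous_map ?X ?Y (\<lambda>a. f (0, a))"
      using f_cont_t f_nz by (auto simp: continuous_map_in_subtopology)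
    show "topspace ?X \<noteq> {}"
      by simp
    show "(\<chi> i. \<phi> i h * y $ i) \<in> topspace ?Y" if "y \<in> topspace ?Y" for y
      using that G'(5) [OF \<phi>'(1) [OF h(1)]] by (auto simp: vec_eq_iff)
    show "f (0, h *s x) = (\<chi> i. \<phi> i h * f (0, x) $ i)" for x
      by (rule equiv)
  qed (use F \<open>c \<noteq> 0\<close> in \<open>auto simp: rotation_cover_def\<close>)
  then show False
    using null by blast
qed

theorem theorem1:
  shows
    "(\<forall>G (\<mu> :: 'n::finite \<Rightarrow> (real ^ 'n) set \<Rightarrow> real) \<phi>.
        subgroup G sphere_group \<and> finite G \<and> G \<noteq> {1} \<and>
        (\<forall>i. mass_distribution (\<mu> i)) \<and>
        (\<forall>i. \<phi> i \<in> iso (sphere_group\<lparr>carrier := G\<rparr>) (sphere_group\<lparr>carrier := G\<rparr>)) \<longrightarrow>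
        (\<exists>a \<in> sphere 0 1. \<exists>b. \<forall>i.
          (\<Sum>g\<in>G. inverse (\<phi> i g) * \<mu> i (voronoi_region G a b g)) = 0)) \<and>
     (\<forall>G (\<mu> :: 'n::finite \<Rightarrow> (complex ^ 'n) set \<Rightarrow> complex) \<phi>.
        subgroup G sphere_group \<and> finite G \<and> G \<noteq> {1} \<and>
        (\<forall>i. mass_distribution (\<mu> i)) \<and>
        (\<forall>i. \<phi> i \<in> iso (sphere_group\<lparr>carrier := G\<rparr>) (sphere_group\<lparr>carrier := G\<rparr>)) \<longrightarrow>
        (\<exists>a \<in> sphere 0 1. \<exists>b. \<forall>i.
          (\<Sum>g\<in>G. inverse (\<phi> i g) * \<mu> i (voronoi_region G a b g)) = 0)) \<and>
     (\<forall>G (\<mu> :: 'n::finite \<Rightarrow> (quat ^ 'n) set \<Rightarrow> quat) \<phi>.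
        subgroup G sphere_group \<and> finite G \<and> G \<noteq> {1} \<and>
        (\<forall>i. mass_distribution (\<mu> i)) \<and>
        (\<forall>i. \<phi> i \<in> iso (sphere_group\<lparr>carrier := G\<rparr>) (sphere_group\<lparr>carrier := G\<rparr>)) \<longrightarrow>
        (\<exists>a \<in> sphere 0 1. \<exists>b. \<forall>i.
          (\<Sum>g\<in>G. inverse (\<phi> i g) * \<mu> i (voronoi_region G a b g)) = 0))"
proof -
  \<comment> \<open>This matches the row count of \<open>rotation_cover_quat\<close> with the one in
    \<open>voronoi_equipartition\<close>.\<close>
  have "DIM(quat) = 4"
    by (simp add: Basis_quat_def)
  then show ?thesis
    using rotation_cover_real rotation_cover_complex rotation_cover_quat
    by (intro conjI allI impI; elim conjE; intro voronoi_equipartition) auto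
qed

end
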